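(* Consider the system (with $'=\frac{d}{ds}$, $s\in\mathbb{C}$) $$\phi'=\frac{-\left(i-\frac1s\right)\phi-\frac{1}{s^{3}}+\frac{i}{2s}(\phi^2-\varphi^2)}{1+s^2\phi\varphi},\qquad \varphi'=\frac{\left(i+\frac1s\right)\varphi-\frac{1}{s^{3}}+\frac{i}{2s}(\phi^2-\varphi^2)}{1+s^2\phi\varphi},$$ which is the inner equation of the unfolding of the Hopf-zero singularity $$\dot x=-xz+\left(\tfrac{\alpha(\delta^2)}{\delta}+cz\right)y+\delta^{-2}f,\quad \dot y=-\left(\tfrac{\alpha(\delta^2)}{\delta}+cz\right)x-yz+\delta^{-2}g,\quad \dot z=-1+b(x^2+y^2)+z^2+\delta^{-2}h,$$ with $f,g,h$ evaluated at $(\delta x,\delta y,\delta z,\delta)$, for $\alpha(0)=1$, $b=1$, $g=h=0$ and $f(X,Y,Z,\delta)=Z^3+2XYZ$. Let $\psi^{\pm}=(\phi^\pm,\varphi^\pm)$ be the two distinguished solutions of this inner equation described in the context, and let $$\Theta=\lim_{\Im s\to-\infty}s^{-1}e^{is}\left(\phi^+(s)-\phi^-(s)\right)\qquad(\Re s=0)$$ be the associated Stokes constant. Then $\Theta\neq0$.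
   Context: Fix $\beta\in(0,\pi/2)$ with $6\sin^2\beta=1$. For $\rho>0$ put $$\mathcal{D}^-_\rho=\{s\in\mathbb{C}:\ |\Im s|\ge \tan\beta\,\Re s+\rho,\ \Re s\le 0\},\qquad \mathcal{D}^+_\rho=\{s: -s\in\mathcal{D}^-_\rho\}.$$ It is known (Baldomá--Seara) that, for $\rho$ large enough, the inner equation has solutions $\psi^\pm=(\phi^\pm,\varphi^\pm)$, analytic in $\mathcal{D}^\pm_\rho$, with $\lim_{\Re s\to\pm\infty}\psi^\pm(s)=0$. They are the solutions obtained by a contraction argument in the space of pairs with $\sup_{s\in\mathcal{D}^\pm_\rho}|s^3\phi^\pm(s)|<\infty$ and $\sup_{s\in\mathcal{D}^\pm_\rho}|s^3\varphi^\pm(s)|<\infty$. The limit defining $\Theta$ is also known to exist, and it does not depend on $\rho$. *)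

theory Defs
  imports "HOL-Complex_Analysis.Complex_Analysis"
begin

definition D_minus :: "real \<Rightarrow> real \<Rightarrow> complex set" where
  "D_minus \<beta> \<rho> = {s. \<bar>Im s\<bar> \<ge> tan \<beta> * Re s + \<rho> \<and> Re s \<le> 0}"

definition D_plus :: "real \<Rightarrow> real \<Rightarrow> complex set" where
  "D_plus \<beta> \<rho> = {s. - s \<in> D_minus \<beta> \<rho>}"

(* In the variables X = \<delta>x, Y = \<delta>y, Z = \<delta>z and the time t/\<delta>, the unfolding becomes, for
   \<delta> = 0, \<alpha> = b = 1, c = 0, g = h = 0 and f = Z^3 + 2XYZ,
     X' = -XZ + Y + Z^3 + 2XYZ,  Y' = -X - YZ,  Z' = X^2 + Y^2 + Z^2.
   Putting Z = -1/s, \<phi> = X + iY, \<psi> = X - iY and taking s as the new time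
   gives the vector field (inner_phi, inner_psi). The second unknown, often written
   as a variant phi, is called \<psi>; it is not the complex conjugate of \<phi> for complex s. *)

definition inner_phi :: "complex \<Rightarrow> complex \<Rightarrow> complex \<Rightarrow> complex" where
  "inner_phi s \<phi> \<psi> =
     (- (\<i> - 1 / s) * \<phi> - 1 / s ^ 3 + \<i> / (2 * s) * (\<phi>\<^sup>2 - \<psi>\<^sup>2)) / (1 + s\<^sup>2 * \<phi> * \<psi>)"

definition inner_psi :: "complex \<Rightarrow> complex \<Rightarrow> complex \<Rightarrow> complex" where
  "inner_psi s \<phi> \<psi> =
     ((\<i> + 1 / s) * \<psi> - 1 / s ^ 3 + \<i> / (2 * s) * (\<phi>\<^sup>2 - \<psi>\<^sup>2)) / (1 + s\<^sup>2 * \<phi> * \<psi>)"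

(* Division is total, so the right-hand sides being defined has to be required. *)
definition solves_inner ::
  "complex set \<Rightarrow> (complex \<Rightarrow> complex) \<Rightarrow> (complex \<Rightarrow> complex) \<Rightarrow> bool" where
  "solves_inner D \<phi> \<psi> \<longleftrightarrow>
     (\<forall>s\<in>D. s \<noteq> 0 \<and> 1 + s\<^sup>2 * \<phi> s * \<psi> s \<noteq> 0 \<and>
        (\<phi> has_field_derivative inner_phi s (\<phi> s) (\<psi> s)) (at s) \<and>
        (\<psi> has_field_derivative inner_psi s (\<phi> s) (\<psi> s)) (at s))"

(* The domains are closed, so analytic_on means analytic on a neighbourhood.
   F is the direction (Re s to plus or minus infinity) in which the solution vanishes. *)
definition distinguished_solution ::
  "complex set \<Rightarrow> complex filter \<Rightarrow> (complex \<Rightarrow> complex) \<Rightarrow> (complex \<Rightarrow> complex) \<Rightarrow> bool" where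
  "distinguished_solution D F \<phi> \<psi> \<longleftrightarrow>
     \<phi> analytic_on D \<and> \<psi> analytic_on D \<and> solves_inner D \<phi> \<psi> \<and>
     ((\<lambda>s. (\<phi> s, \<psi> s)) \<longlongrightarrow> (0, 0)) (inf F (principal D)) \<and>
     bdd_above ((\<lambda>s. cmod (s ^ 3 * \<phi> s)) ` D) \<and>
     bdd_above ((\<lambda>s. cmod (s ^ 3 * \<psi> s)) ` D)"

end

theory Submission
  imports Defs
begin

text \<open>Suppose the Stokes constant vanishes. On the ray $s = -iy$ the difference of the two solutions
  satisfies a perturbed diagonal linear system with one growing and one decaying mode; boundedness
  excludes the growing mode and a vanishing Stokes constant excludes the decaying one, so the two
  solutions agree there. Decaying solutions are unique along horizontal rays, hence invariant under
  $(\phi, \psi)(s) \mapsto (\overline{\psi(\bar s)}, \overline{\phi(\bar s)})$, which carries the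
  agreement over to the upper imaginary axis. Glued together, the two solutions form a solution that is
  holomorphic near infinity, that is, the formal solution $\sum_n a_n s^{-n}$ converges. But its recursion reads
  $i a_n = n a_{n-1} - [n = 3] + E_n$, where $E_n$ vanishes for $n < 7$ and is $O((n-3)!)$ with a small
  constant; so $|a_n| / n!$ stays close to $|a_3| / 3! = 1/6$ and the series diverges.\<close>

text \<open>The factor \<open>inverse s * exp (\<i> * s)\<close> in the Stokes constant is the
  reciprocal of \<open>s * exp (- \<i> * s)\<close>, which solves the diagonal linear part of the
  first equation. At s = -iy that solution has modulus y e^(-y), while its companion in the second
  equation has modulus y e^y. So \<Theta> is the amplitude of the one mode that boundedness cannot
  exclude on the lower axis. On the upper axis the modes exchange roles and \<Theta> gives no direct
  information, whence the detour through a reflection. Differences are compared through squared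
  moduli and one-sided differential inequalities instead of integral equations. The nonlinear terms
  need only have a coefficient O(|s|^(-2)): it is integrable at infinity and is absorbed by a
  bounded integrating factor. Nonvanishing can be settled by hand because the forcing 1/s^3 makes
  every solution start at order 3. Quadratic terms then start at order 6 and enter the recursion
  only at order 7, where (n-3)!/n! is already so small that all perturbations together stay well
  below 1/6.\<close>

section \<open>Linearization of the inner vector field\<close>

text \<open>With \<open>f\<close> the second quotient, multiplying by \<open>1 + w1\<close> cancels
  every term linear in \<open>l\<close> except one carrying the small factor \<open>w1\<close>; what
  remains is \<open>(g1 - g2) - f * (w1 - w2) - w1 * l * (x1 - x2)\<close>. Dividing by
  \<open>1 + w1\<close> again costs at most a factor 2.\<close>

lemma norm_perturbed_quotient_diff:
  fixes l x1 x2 g1 g2 w1 w2 :: complex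
  assumes w1: "norm w1 \<le> 1/2" and w2: "norm w2 \<le> 1/2" and l: "norm l \<le> 2"
  shows "norm ((l * x1 + g1) / (1 + w1) - (l * x2 + g2) / (1 + w2) - l * (x1 - x2))
    \<le> 2 * (norm (g1 - g2) + 2 * (2 * norm x2 + norm g2) * norm (w1 - w2) + 2 * norm w1 * norm (x1 - x2))"
proof -
  have n: "norm (1 + w) \<ge> 1/2" if "norm w \<le> 1/2" for w :: complex
    using norm_triangle_ineq2[of 1 "- w"] that by simp
  have n1: "norm (1 + w1) \<ge> 1/2" and n2: "norm (1 + w2) \<ge> 1/2" using n w1 w2 by auto
  have nz: "1 + w1 \<noteq> 0" "1 + w2 \<noteq> 0" using n1 n2 by force+
  define f where "f = (l * x2 + g2) / (1 + w2)"
  have div2: "norm a / norm b \<le> 2 * norm a" if "norm b \<ge> 1/2" for a b :: complex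
  proof -
    have "norm a / norm b \<le> norm a / (1/2)"
      using that by (intro divide_left_mono) auto
    then show ?thesis by simp
  qed
  have "norm f \<le> 2 * norm (l * x2 + g2)"
    unfolding f_def norm_divide by (rule div2[OF n2])
  also have "\<dots> \<le> 2 * (2 * norm x2 + norm g2)"
    using norm_triangle_ineq[of "l * x2" g2] mult_right_mono[OF l, of "norm x2"]
    by (simp add: norm_mult)
  finally have nf: "norm f \<le> 2 * (2 * norm x2 + norm g2)" .
  define e where "e = (g1 - g2) - f * (w1 - w2) - w1 * l * (x1 - x2)"
  have fe: "f * (1 + w2) = l * x2 + g2" using nz by (simp add: f_def)
  have "(l * x1 + g1) / (1 + w1) - f - l * (x1 - x2)
      = ((l * x1 + g1) - f * (1 + w1) - l * (x1 - x2) * (1 + w1)) / (1 + w1)"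
    using nz by (simp add: diff_divide_distrib)
  also have "(l * x1 + g1) - f * (1 + w1) - l * (x1 - x2) * (1 + w1) = e"
  proof -
    have "f = l * x2 + g2 - f * w2" using fe by (simp add: algebra_simps)
    then show ?thesis unfolding e_def
      by (simp add: algebra_simps)
  qed
  finally have eq: "(l * x1 + g1) / (1 + w1) - f - l * (x1 - x2) = e / (1 + w1)" .
  have "norm e \<le> norm (g1 - g2) + norm (f * (w1 - w2)) + norm (w1 * l * (x1 - x2))"
    unfolding e_def by (meson norm_triangle_ineq4 order_trans add_right_mono)
  also have "\<dots> \<le> norm (g1 - g2) + 2 * (2 * norm x2 + norm g2) * norm (w1 - w2) + 2 * norm w1 * norm (x1 - x2)"
    unfolding norm_mult
    by (intro add_mono order_refl mult_right_mono nf norm_ge_zero)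
       (use mult_left_mono[OF l, of "norm w1"] in simp)
  finally have ne: "norm e \<le> norm (g1 - g2) + 2 * (2 * norm x2 + norm g2) * norm (w1 - w2) + 2 * norm w1 * norm (x1 - x2)" .
  have "norm (e / (1 + w1)) \<le> 2 * norm e"
    unfolding norm_divide by (rule div2[OF n1])
  then show ?thesis using ne eq by (simp add: f_def)
qed

text \<open>Two cubically decaying solutions differ by a solution of an almost diagonal linear
  system. What matters is that the error coefficient decays like |s|^(-2), hence is integrable along
  every ray used later.\<close>

lemma inner_field_near_linear:
  fixes s \<phi>1 \<psi>1 \<phi>2 \<psi>2 :: complex and C :: real
  assumes C: "C \<ge> 1" and s: "norm s \<ge> 2 * C"
    and b: "norm \<phi>1 \<le> C / norm s ^ 3" "norm \<psi>1 \<le> C / norm s ^ 3"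
      "norm \<phi>2 \<le> C / norm s ^ 3" "norm \<psi>2 \<le> C / norm s ^ 3"
  defines "d \<equiv> norm (\<phi>1 - \<phi>2) + norm (\<psi>1 - \<psi>2)"
  shows "norm (inner_phi s \<phi>1 \<psi>1 - inner_phi s \<phi>2 \<psi>2 - (- (\<i> - 1 / s)) * (\<phi>1 - \<phi>2)) \<le> 22 * C\<^sup>2 / norm s ^ 2 * d"
    and "norm (inner_psi s \<phi>1 \<psi>1 - inner_psi s \<phi>2 \<psi>2 - (\<i> + 1 / s) * (\<psi>1 - \<psi>2)) \<le> 22 * C\<^sup>2 / norm s ^ 2 * d"
proof -
  define t where "t = 1 / norm s"
  have sp: "norm s > 0" using C s by linarith
  have t0: "0 < t" using sp by (simp add: t_def)
  have Ct: "C * t \<le> 1/2" using s sp by (simp add: t_def field_simps)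
  have t1: "t \<le> 1/2" using Ct mult_right_mono[OF C, of t] t0 by linarith
  have b': "norm \<phi>1 \<le> C * t ^ 3" "norm \<psi>1 \<le> C * t ^ 3" "norm \<phi>2 \<le> C * t ^ 3" "norm \<psi>2 \<le> C * t ^ 3"
    using b by (simp_all add: t_def power_divide)
  have d0: "d \<ge> 0" by (simp add: d_def)
  have dp: "norm (\<phi>1 - \<phi>2) \<le> d" "norm (\<psi>1 - \<psi>2) \<le> d" by (simp_all add: d_def)
  have st: "norm s * t = 1" using sp by (simp add: t_def)
  have t4: "t ^ 4 \<le> t ^ 2" using t0 t1 by (intro power_decreasing) auto
  have p: "norm (s\<^sup>2 * u * v) \<le> norm v * (C * t)" if "norm u \<le> C * t ^ 3" for u v
  proof -
    have "norm (s\<^sup>2 * u * v) \<le> (norm s)\<^sup>2 * (C * t ^ 3) * norm v"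
      using that by (simp add: norm_mult norm_power mult_left_mono mult_right_mono)
    also have "\<dots> = (norm s * t)\<^sup>2 * (norm v * (C * t))" by algebra
    finally show ?thesis by (simp add: st)
  qed
  have w: "norm (s\<^sup>2 * u * v) \<le> C\<^sup>2 * t ^ 4" if "norm u \<le> C * t ^ 3" "norm v \<le> C * t ^ 3" for u v
  proof -
    have "norm (s\<^sup>2 * u * v) \<le> (C * t ^ 3) * (C * t)"
      using C t0 by (intro order_trans[OF p[OF that(1), of v] mult_right_mono[OF that(2)]]) auto
    also have "\<dots> = C\<^sup>2 * t ^ 4" by algebra
    finally show ?thesis .
  qed
  have C2: "C\<^sup>2 * t ^ 4 \<le> 1/16"
  proof -
    have "C\<^sup>2 * t ^ 4 = (C * t)\<^sup>2 * t\<^sup>2" by algebra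
    also have "\<dots> \<le> (1/2)\<^sup>2 * (1/2)\<^sup>2"
      using Ct t1 t0 C by (intro mult_mono power_mono) auto
    finally show ?thesis by (simp add: power2_eq_square)
  qed
  define w1 where "w1 = s\<^sup>2 * \<phi>1 * \<psi>1"
  define w2 where "w2 = s\<^sup>2 * \<phi>2 * \<psi>2"
  \<comment> \<open>The forcing \<open>- 1 / s ^ 3\<close> is kept in \<open>g1\<close> and
    \<open>g2\<close>: it cancels in \<open>g1 - g2\<close>, but the two denominators differ, so it
    survives in the product of \<open>norm g2\<close> and \<open>norm (w1 - w2)\<close>.\<close>
  define g1 where "g1 = - 1 / s ^ 3 + \<i> / (2 * s) * (\<phi>1\<^sup>2 - \<psi>1\<^sup>2)"
  define g2 where "g2 = - 1 / s ^ 3 + \<i> / (2 * s) * (\<phi>2\<^sup>2 - \<psi>2\<^sup>2)"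
  have nw1: "norm w1 \<le> C\<^sup>2 * t ^ 4" and nw2: "norm w2 \<le> C\<^sup>2 * t ^ 4"
    using w b' by (auto simp: w1_def w2_def)
  have dw: "norm (w1 - w2) \<le> (C * t) * d"
  proof -
    have "w1 - w2 = s\<^sup>2 * \<psi>1 * (\<phi>1 - \<phi>2) + s\<^sup>2 * \<phi>2 * (\<psi>1 - \<psi>2)"
      by (simp add: w1_def w2_def algebra_simps)
    then have "norm (w1 - w2) \<le> norm (s\<^sup>2 * \<psi>1 * (\<phi>1 - \<phi>2)) + norm (s\<^sup>2 * \<phi>2 * (\<psi>1 - \<psi>2))"
      using norm_triangle_ineq by metis
    also have "\<dots> \<le> norm (\<phi>1 - \<phi>2) * (C * t) + norm (\<psi>1 - \<psi>2) * (C * t)"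
      by (intro add_mono p b')
    also have "\<dots> = (C * t) * d" by (simp add: d_def algebra_simps)
    finally show ?thesis .
  qed
  have norm_i2s: "norm (\<i> / (2 * s)) = t / 2" by (simp add: norm_divide norm_mult t_def)
  have Ct3: "0 \<le> C * t ^ 3" using C t0 by simp
  have dg: "norm (g1 - g2) \<le> C * t ^ 4 * d"
  proof -
    have "g1 - g2 = \<i> / (2 * s) * ((\<phi>1 + \<phi>2) * (\<phi>1 - \<phi>2) - (\<psi>1 + \<psi>2) * (\<psi>1 - \<psi>2))"
    proof -
      have "(p + c * (u\<^sup>2 - v\<^sup>2)) - (p + c * (x\<^sup>2 - y\<^sup>2)) = c * ((u + x) * (u - x) - (v + y) * (v - y))"
        for p c u v x y :: complex by algebra
      then show ?thesis unfolding g1_def g2_def .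
    qed
    then have "norm (g1 - g2) = t / 2 * norm ((\<phi>1 + \<phi>2) * (\<phi>1 - \<phi>2) - (\<psi>1 + \<psi>2) * (\<psi>1 - \<psi>2))"
      by (simp only: norm_mult norm_i2s)
    also have "\<dots> \<le> t / 2 * ((C * t ^ 3 + C * t ^ 3) * norm (\<phi>1 - \<phi>2) + (C * t ^ 3 + C * t ^ 3) * norm (\<psi>1 - \<psi>2))"
    proof (intro mult_left_mono)
      have "norm ((\<phi>1 + \<phi>2) * (\<phi>1 - \<phi>2)) \<le> (C * t ^ 3 + C * t ^ 3) * norm (\<phi>1 - \<phi>2)"
        unfolding norm_mult by (intro mult_right_mono norm_triangle_mono b') auto
      moreover have "norm ((\<psi>1 + \<psi>2) * (\<psi>1 - \<psi>2)) \<le> (C * t ^ 3 + C * t ^ 3) * norm (\<psi>1 - \<psi>2)"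
        unfolding norm_mult by (intro mult_right_mono norm_triangle_mono b') auto
      ultimately show "norm ((\<phi>1 + \<phi>2) * (\<phi>1 - \<phi>2) - (\<psi>1 + \<psi>2) * (\<psi>1 - \<psi>2))
          \<le> (C * t ^ 3 + C * t ^ 3) * norm (\<phi>1 - \<phi>2) + (C * t ^ 3 + C * t ^ 3) * norm (\<psi>1 - \<psi>2)"
        using norm_triangle_ineq4[of "(\<phi>1 + \<phi>2) * (\<phi>1 - \<phi>2)" "(\<psi>1 + \<psi>2) * (\<psi>1 - \<psi>2)"] by linarith
    qed (use t0 in simp)
    also have "\<dots> = C * t ^ 4 * d" by (simp add: d_def algebra_simps eval_nat_numeral)
    finally show ?thesis .
  qed
  have ng: "norm g2 \<le> 2 * t ^ 3"
  proof -
    have sq: "norm (u\<^sup>2) \<le> (C * t ^ 3)\<^sup>2" if "norm u \<le> C * t ^ 3" for u :: complex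
      unfolding norm_power using that by (intro power_mono) auto
    have "norm (\<i> / (2 * s) * (\<phi>2\<^sup>2 - \<psi>2\<^sup>2)) \<le> t / 2 * ((C * t ^ 3)\<^sup>2 + (C * t ^ 3)\<^sup>2)"
      unfolding norm_mult norm_i2s using t0 sq[OF b'(3)] sq[OF b'(4)] norm_triangle_ineq4[of "\<phi>2\<^sup>2" "\<psi>2\<^sup>2"]
      by (intro mult_left_mono) auto
    also have "\<dots> = (C\<^sup>2 * t ^ 4) * t ^ 3" by algebra
    also have "\<dots> \<le> 1 * t ^ 3" using C2 t0 by (intro mult_right_mono) auto
    finally have "norm (\<i> / (2 * s) * (\<phi>2\<^sup>2 - \<psi>2\<^sup>2)) \<le> t ^ 3" by simp
    moreover have "norm (- 1 / s ^ 3) = t ^ 3"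
      by (simp add: norm_divide norm_power t_def power_divide)
    ultimately show ?thesis
      using norm_triangle_ineq[of "- 1 / s ^ 3" "\<i> / (2 * s) * (\<phi>2\<^sup>2 - \<psi>2\<^sup>2)"] by (simp add: g2_def)
  qed
  have main: "norm ((l * x1 + g1) / (1 + w1) - (l * x2 + g2) / (1 + w2) - l * (x1 - x2)) \<le> 22 * C\<^sup>2 / norm s ^ 2 * d"
    if l: "norm l \<le> 2" and x2: "norm x2 \<le> C * t ^ 3" and dx: "norm (x1 - x2) \<le> d" for l x1 x2
  proof -
    have "norm ((l * x1 + g1) / (1 + w1) - (l * x2 + g2) / (1 + w2) - l * (x1 - x2))
      \<le> 2 * (norm (g1 - g2) + 2 * (2 * norm x2 + norm g2) * norm (w1 - w2) + 2 * norm w1 * norm (x1 - x2))"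
      using nw1 nw2 C2 l by (intro norm_perturbed_quotient_diff) auto
    also have "\<dots> \<le> 2 * (C * t ^ 4 * d + 2 * (2 * (C * t ^ 3) + 2 * t ^ 3) * ((C * t) * d) + 2 * (C\<^sup>2 * t ^ 4) * d)"
      using dg x2 ng dw nw1 dx Ct3 t0 d0 C
      by (intro mult_left_mono add_mono mult_mono) auto
    also have "\<dots> = (2 * C + 12 * C\<^sup>2 + 8 * C) * (t ^ 4 * d)" by algebra
    \<comment> \<open>22 = 2 + 12 + 8, by \<open>C \<le> C^2\<close>; the fourth power of
      \<open>t\<close> is weakened to the second, which integrability still allows.\<close>
    also have "\<dots> \<le> (22 * C\<^sup>2) * (t ^ 2 * d)"
    proof (intro mult_mono)
      show "2 * C + 12 * C\<^sup>2 + 8 * C \<le> 22 * C\<^sup>2" using C by (simp add: power2_eq_square)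
    qed (use t4 d0 C in \<open>auto intro: mult_right_mono\<close>)
    finally show ?thesis by (simp add: t_def power_divide)
  qed
  have inv: "norm (1 / s) \<le> 1" using t1 by (simp add: t_def norm_divide)
  have "norm (- (\<i> - 1 / s)) \<le> 2" "norm (\<i> + 1 / s) \<le> 2"
    using norm_triangle_ineq4[of \<i> "1 / s"] norm_triangle_ineq[of \<i> "1 / s"] inv
    by (auto simp: norm_minus_commute)
  from main[OF this(1) b'(3) dp(1)] main[OF this(2) b'(4) dp(2)]
  show "norm (inner_phi s \<phi>1 \<psi>1 - inner_phi s \<phi>2 \<psi>2 - (- (\<i> - 1 / s)) * (\<phi>1 - \<phi>2)) \<le> 22 * C\<^sup>2 / norm s ^ 2 * d"
    "norm (inner_psi s \<phi>1 \<psi>1 - inner_psi s \<phi>2 \<psi>2 - (\<i> + 1 / s) * (\<psi>1 - \<psi>2)) \<le> 22 * C\<^sup>2 / norm s ^ 2 * d"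
    by (simp_all add: inner_phi_def inner_psi_def g1_def g2_def w1_def w2_def algebra_simps)
qed

section \<open>Energy inequalities along rays\<close>

text \<open>This takes the place of a Gronwall argument started at infinity: a nonnegative energy
  times a positive integrating factor that satisfies the hypotheses has to vanish.\<close>

lemma nonpos_if_deriv_nonneg_tendsto_0:
  fixes f :: "real \<Rightarrow> real"
  assumes der: "\<And>x. x \<ge> a \<Longrightarrow> \<exists>D. (f has_real_derivative D) (at x) \<and> D \<ge> 0"
    and lim: "(f \<longlongrightarrow> 0) at_top" and x: "x \<ge> a"
  shows "f x \<le> 0"
proof -
  have "f x \<le> f y" if "x \<le> y" for y
    using DERIV_nonneg_imp_nondecreasing[OF that, of f] der x by force
  then have "\<forall>\<^sub>F y in at_top. f x \<le> f y"
    by (intro eventually_mono[OF eventually_ge_at_top[of x]])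
  then show ?thesis
    using tendsto_lowerbound[OF lim] by simp
qed

lemma has_real_derivative_cmod_power2:
  fixes u :: "real \<Rightarrow> complex"
  assumes "(u has_vector_derivative u') (at x)"
  shows "((\<lambda>x. (cmod (u x))\<^sup>2) has_real_derivative 2 * Re (cnj (u x) * u')) (at x)"
proof -
  have "((\<lambda>x. Re (u x)) has_real_derivative Re u') (at x)" "((\<lambda>x. Im (u x)) has_real_derivative Im u') (at x)"
    using bounded_linear.has_vector_derivative[OF bounded_linear_Re assms]
      bounded_linear.has_vector_derivative[OF bounded_linear_Im assms]
    by (simp_all add: has_real_derivative_iff_has_vector_derivative)
  moreover have "((\<lambda>x. (p x)\<^sup>2 + (q x)\<^sup>2) has_real_derivative 2 * (p x * p' + q x * q')) (at x)"
    if "(p has_real_derivative p') (at x)" "(q has_real_derivative q') (at x)" for p q :: "real \<Rightarrow> real" and p' q'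
    using that by (auto intro!: derivative_eq_intros simp: algebra_simps)
  ultimately show ?thesis
    unfolding cmod_power2 by simp
qed


text \<open>Only the equations and one explicit size bound are retained. This notion passes to
  subsets such as rays or the imaginary axis, and a common \<open>C\<close> for both solutions
  yields common thresholds.\<close>

definition decaying_solution ::
  "real \<Rightarrow> complex set \<Rightarrow> (complex \<Rightarrow> complex) \<Rightarrow> (complex \<Rightarrow> complex) \<Rightarrow> bool" where
  "decaying_solution C S \<phi> \<psi> \<longleftrightarrow>
     solves_inner S \<phi> \<psi> \<and> (\<forall>s\<in>S. norm (\<phi> s) \<le> C / norm s ^ 3 \<and> norm (\<psi> s) \<le> C / norm s ^ 3)"

text \<open>Squared moduli stay differentiable where the difference vanishes. Their derivative is
  \<open>2 * Re (cnj u * u')\<close>, so a diagonal coefficient acts only through its real part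
  after multiplication by the direction \<open>v\<close>; choosing the ray therefore decides whether
  a mode grows, decays or merely oscillates.\<close>

lemma difference_energy_derivatives:
  fixes \<gamma> :: "real \<Rightarrow> complex" and C r :: real
  assumes sol: "decaying_solution C S \<phi>1 \<psi>1" "decaying_solution C S \<phi>2 \<psi>2"
    and C: "C \<ge> 1" and in_S: "\<gamma> r \<in> S" and large: "norm (\<gamma> r) \<ge> 2 * C"
    and \<gamma>: "(\<gamma> has_vector_derivative v) (at r)" and v: "norm v = 1"
  defines "A \<equiv> \<lambda>r. (norm (\<phi>1 (\<gamma> r) - \<phi>2 (\<gamma> r)))\<^sup>2"
    and "B \<equiv> \<lambda>r. (norm (\<psi>1 (\<gamma> r) - \<psi>2 (\<gamma> r)))\<^sup>2"
  obtains a b where "(A has_real_derivative a) (at r)" "(B has_real_derivative b) (at r)"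
    "\<bar>a - 2 * Re (- v * (\<i> - 1 / \<gamma> r)) * A r\<bar> \<le> 66 * C\<^sup>2 / norm (\<gamma> r) ^ 2 * (A r + B r)"
    "\<bar>b - 2 * Re (v * (\<i> + 1 / \<gamma> r)) * B r\<bar> \<le> 66 * C\<^sup>2 / norm (\<gamma> r) ^ 2 * (A r + B r)"
proof -
  define s where "s = \<gamma> r"
  define U where "U = (\<lambda>r. \<phi>1 (\<gamma> r) - \<phi>2 (\<gamma> r))"
  define V where "V = (\<lambda>r. \<psi>1 (\<gamma> r) - \<psi>2 (\<gamma> r))"
  define fU where "fU = inner_phi s (\<phi>1 s) (\<psi>1 s) - inner_phi s (\<phi>2 s) (\<psi>2 s)"
  define fV where "fV = inner_psi s (\<phi>1 s) (\<psi>1 s) - inner_psi s (\<phi>2 s) (\<psi>2 s)"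
  define K where "K = 22 * C\<^sup>2 / norm s ^ 2"
  have K0: "K \<ge> 0" by (simp add: K_def)
  have der: "(f \<circ> \<gamma> has_vector_derivative v * f') (at r)" if "(f has_field_derivative f') (at s)" for f f'
    using field_vector_diff_chain_at[OF \<gamma>] that by (simp add: s_def)
  have sS: "s \<in> S" using in_S by (simp add: s_def)
  note sol' = sol[unfolded decaying_solution_def solves_inner_def]
  have "((\<lambda>r. (\<phi>1 \<circ> \<gamma>) r - (\<phi>2 \<circ> \<gamma>) r) has_vector_derivative v * inner_phi s (\<phi>1 s) (\<psi>1 s) - v * inner_phi s (\<phi>2 s) (\<psi>2 s)) (at r)"
    using sol' sS by (intro has_vector_derivative_diff der) auto
  then have U': "(U has_vector_derivative v * fU) (at r)"
    by (simp add: U_def fU_def algebra_simps)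
  have "((\<lambda>r. (\<psi>1 \<circ> \<gamma>) r - (\<psi>2 \<circ> \<gamma>) r) has_vector_derivative v * inner_psi s (\<phi>1 s) (\<psi>1 s) - v * inner_psi s (\<phi>2 s) (\<psi>2 s)) (at r)"
    using sol' sS by (intro has_vector_derivative_diff der) auto
  then have V': "(V has_vector_derivative v * fV) (at r)"
    by (simp add: V_def fV_def algebra_simps)
  have bnd: "norm (fU - (- (\<i> - 1 / s)) * U r) \<le> K * (norm (U r) + norm (V r))"
    "norm (fV - (\<i> + 1 / s) * V r) \<le> K * (norm (U r) + norm (V r))"
    using inner_field_near_linear[OF C, of s "\<phi>1 s" "\<psi>1 s" "\<phi>2 s" "\<psi>2 s"] large sol' sS
    by (simp_all add: fU_def fV_def U_def V_def K_def s_def)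
  have est: "\<bar>2 * Re (cnj u * (v * f)) - 2 * Re (v * l) * (norm u)\<^sup>2\<bar> \<le> 3 * K * ((norm (U r))\<^sup>2 + (norm (V r))\<^sup>2)"
    if bf: "norm (f - l * u) \<le> K * (norm (U r) + norm (V r))" and u: "u = U r \<or> u = V r" for u f l
  proof -
    have uu: "cnj u * u = complex_of_real ((norm u)\<^sup>2)"
      by (metis complex_norm_square mult.commute)
    have "cnj u * (v * f) = (cnj u * u) * (v * l) + cnj u * (v * (f - l * u))"
      by (simp add: algebra_simps)
    then have "Re (cnj u * (v * f)) = (norm u)\<^sup>2 * Re (v * l) + Re (cnj u * (v * (f - l * u)))"
      unfolding uu by simp
    moreover have "2 * x - 2 * \<rho> * n = 2 * z" if "x = n * \<rho> + z" for x \<rho> n z :: real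
      using that by (simp add: algebra_simps)
    ultimately have "\<bar>2 * Re (cnj u * (v * f)) - 2 * Re (v * l) * (norm u)\<^sup>2\<bar> = 2 * \<bar>Re (cnj u * (v * (f - l * u)))\<bar>"
      by (simp only: abs_mult abs_numeral)
    also have "\<dots> \<le> 2 * norm (cnj u * (v * (f - l * u)))"
      by (intro mult_left_mono abs_Re_le_cmod) simp
    also have "\<dots> \<le> 2 * (norm u * (K * (norm (U r) + norm (V r))))"
      using mult_left_mono[OF bf norm_ge_zero[of u]] v by (simp add: norm_mult)
    also have "\<dots> = K * (2 * norm u * (norm (U r) + norm (V r)))" by simp
    also have "\<dots> \<le> K * (3 * ((norm (U r))\<^sup>2 + (norm (V r))\<^sup>2))"
    proof (rule mult_left_mono[OF _ K0])
      \<comment> \<open>Bounding the cross terms by the sum of both energies costs the factor 3,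
        whence 66 = 3 * 22.\<close>
      have "2 * x * (x + y) \<le> 3 * (x\<^sup>2 + y\<^sup>2)" for x y :: real
        using sum_squares_bound[of x y] by (simp add: algebra_simps power2_eq_square) (use zero_le_square[of y] in linarith)
      from this[of "norm (U r)" "norm (V r)"] this[of "norm (V r)" "norm (U r)"]
      show "2 * norm u * (norm (U r) + norm (V r)) \<le> 3 * ((norm (U r))\<^sup>2 + (norm (V r))\<^sup>2)"
        using u by (auto simp: algebra_simps)
    qed
    finally show ?thesis by (simp add: algebra_simps)
  qed
  have AU: "A = (\<lambda>r. (norm (U r))\<^sup>2)" and BV: "B = (\<lambda>r. (norm (V r))\<^sup>2)"
    by (simp_all add: A_def B_def U_def V_def)
  show thesis
  proof (rule that)
    show "(A has_real_derivative 2 * Re (cnj (U r) * (v * fU))) (at r)"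
      unfolding AU by (rule has_real_derivative_cmod_power2[OF U'])
    show "(B has_real_derivative 2 * Re (cnj (V r) * (v * fV))) (at r)"
      unfolding BV by (rule has_real_derivative_cmod_power2[OF V'])
    have "v * (- (\<i> - 1 / s)) = - v * (\<i> - 1 / s)" by (simp add: algebra_simps)
    from est[OF bnd(1), unfolded this]
    show "\<bar>2 * Re (cnj (U r) * (v * fU)) - 2 * Re (- v * (\<i> - 1 / \<gamma> r)) * A r\<bar> \<le> 66 * C\<^sup>2 / norm (\<gamma> r) ^ 2 * (A r + B r)"
      by (simp add: AU BV K_def s_def)
    from est[OF bnd(2)]
    show "\<bar>2 * Re (cnj (V r) * (v * fV)) - 2 * Re (v * (\<i> + 1 / \<gamma> r)) * B r\<bar> \<le> 66 * C\<^sup>2 / norm (\<gamma> r) ^ 2 * (A r + B r)"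
      by (simp add: AU BV K_def s_def)
  qed
qed

text \<open>In a horizontal direction the terms with \<i> only rotate, and by \<open>side\<close>
  the terms with 1/s push both energies upwards. Hence the energies can shrink only at an integrable
  rate, by a bounded factor in total, which is incompatible with their tending to 0 unless they
  vanish. The condition \<open>large\<close> keeps the whole ray where the linearization is
  valid.\<close>

lemma decaying_solution_unique_along_horizontal_ray:
  fixes C \<epsilon> :: real
  assumes sol: "decaying_solution C S \<phi>1 \<psi>1" "decaying_solution C S \<phi>2 \<psi>2"
    and C: "C \<ge> 1" and \<epsilon>: "\<epsilon> = 1 \<or> \<epsilon> = - 1"
    and ray: "\<And>r. r \<ge> 0 \<Longrightarrow> s0 + complex_of_real (\<epsilon> * r) \<in> S"
    and side: "0 \<le> \<epsilon> * Re s0" and large: "\<bar>Im s0\<bar> \<ge> 2 * C"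
  shows "\<phi>1 s0 = \<phi>2 s0 \<and> \<psi>1 s0 = \<psi>2 s0"
proof -
  define \<gamma> where "\<gamma> r = s0 + complex_of_real (\<epsilon> * r)" for r
  define U where "U = (\<lambda>r. \<phi>1 (\<gamma> r) - \<phi>2 (\<gamma> r))"
  define V where "V = (\<lambda>r. \<psi>1 (\<gamma> r) - \<psi>2 (\<gamma> r))"
  define D where "D r = (norm (U r))\<^sup>2 + (norm (V r))\<^sup>2" for r
  define K where "K = 66 * C\<^sup>2"
  \<comment> \<open>Integrating factor: the total energy satisfies
    \<open>D' \<ge> - 2 * K / norm (\<gamma> r) ^ 2 * D\<close>. Since
    \<open>norm (\<gamma> r) ^ 2\<close> is at least half of \<open>(1 + r)^2\<close>, the rate is
    at most \<open>4 * K / (1 + r)^2\<close>, the derivative of the exponent. Using 1 + r rather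
    than r avoids a singularity at the starting point.\<close>
  define F where "F r = D r * exp (- (4 * K) / (1 + r))" for r
  have K0: "K \<ge> 0" by (simp add: K_def)
  have D0: "D r \<ge> 0" for r by (simp add: D_def)
  have n1: "norm (\<gamma> r) \<ge> 2 * C" for r
    using large abs_Im_le_cmod[of "\<gamma> r"] by (simp add: \<gamma>_def)
  have n2: "2 * norm (\<gamma> r) ^ 2 \<ge> (1 + r)\<^sup>2" if "r \<ge> 0" for r
  proof -
    have e2: "\<epsilon>\<^sup>2 = 1" using \<epsilon> by auto
    have "norm (\<gamma> r) ^ 2 = (Re s0)\<^sup>2 + 2 * ((\<epsilon> * Re s0) * r) + \<epsilon>\<^sup>2 * r\<^sup>2 + (Im s0)\<^sup>2"
      unfolding cmod_power2 by (simp add: \<gamma>_def power2_eq_square algebra_simps)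
    moreover have "(Im s0)\<^sup>2 \<ge> 1" using large C one_le_power[of "\<bar>Im s0\<bar>" 2] by simp
    moreover have "(\<epsilon> * Re s0) * r \<ge> 0" using side that by simp
    moreover have "(1 + r)\<^sup>2 \<le> 2 + 2 * r\<^sup>2"
      using zero_le_power2[of "1 - r"] by (simp add: power2_eq_square algebra_simps)
    ultimately show ?thesis unfolding e2 mult_1 using zero_le_power2[of "Re s0"] by linarith
  qed
  have "\<exists>F'. (F has_real_derivative F') (at r) \<and> F' \<ge> 0" if r: "r \<ge> 0" for r
  proof -
    have \<gamma>': "(\<gamma> has_vector_derivative complex_of_real \<epsilon>) (at r)"
      unfolding \<gamma>_def by (auto intro!: derivative_eq_intros simp: has_vector_derivative_def scaleR_conv_of_real)
    have \<gamma>S: "\<gamma> r \<in> S" using ray[OF r] by (simp add: \<gamma>_def)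
    have v1: "norm (complex_of_real \<epsilon>) = 1" using \<epsilon> by auto
    obtain a b where a: "((\<lambda>r. (norm (U r))\<^sup>2) has_real_derivative a) (at r)"
      and b: "((\<lambda>r. (norm (V r))\<^sup>2) has_real_derivative b) (at r)"
      and ab: "\<bar>a - 2 * Re (- complex_of_real \<epsilon> * (\<i> - 1 / \<gamma> r)) * (norm (U r))\<^sup>2\<bar> \<le> K / norm (\<gamma> r) ^ 2 * D r"
       "\<bar>b - 2 * Re (complex_of_real \<epsilon> * (\<i> + 1 / \<gamma> r)) * (norm (V r))\<^sup>2\<bar> \<le> K / norm (\<gamma> r) ^ 2 * D r"
      using difference_energy_derivatives[OF sol C \<gamma>S n1 \<gamma>' v1]
      unfolding U_def V_def D_def K_def by blast
    have re: "\<epsilon> * Re (1 / \<gamma> r) \<ge> 0"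
    proof -
      have "\<epsilon> * Re (\<gamma> r) \<ge> 0" using \<epsilon> side r by (auto simp: \<gamma>_def)
      then show ?thesis by (simp add: Re_divide)
    qed
    have "2 * Re (- complex_of_real \<epsilon> * (\<i> - 1 / \<gamma> r)) * (norm (U r))\<^sup>2 \<ge> 0"
      "2 * Re (complex_of_real \<epsilon> * (\<i> + 1 / \<gamma> r)) * (norm (V r))\<^sup>2 \<ge> 0"
      using re by simp_all
    then have "a + b \<ge> - 2 * (K / norm (\<gamma> r) ^ 2 * D r)" using ab by linarith
    moreover have "K / norm (\<gamma> r) ^ 2 * D r \<le> 2 * K / (1 + r)\<^sup>2 * D r"
    proof (rule mult_right_mono[OF _ D0])
      have "norm (\<gamma> r) > 0" using n1[of r] C by linarith
      then show "K / norm (\<gamma> r) ^ 2 \<le> 2 * K / (1 + r)\<^sup>2"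
        using mult_left_mono[OF n2[OF r] K0] r by (simp add: field_simps)
    qed
    moreover have "D r * (4 * K / (1 + r)\<^sup>2) = 2 * (2 * K / (1 + r)\<^sup>2 * D r)" by simp
    ultimately have nn: "a + b + D r * (4 * K / (1 + r)\<^sup>2) \<ge> 0" by linarith
    have e: "((\<lambda>r. exp (- (4 * K) / (1 + r))) has_real_derivative exp (- (4 * K) / (1 + r)) * (4 * K / (1 + r)\<^sup>2)) (at r)"
      using r by (auto intro!: derivative_eq_intros simp: power2_eq_square)
    have "(F has_real_derivative D r * (exp (- (4 * K) / (1 + r)) * (4 * K / (1 + r)\<^sup>2)) + (a + b) * exp (- (4 * K) / (1 + r))) (at r)"
      unfolding F_def D_def by (rule DERIV_mult'[OF DERIV_add[OF a b] e])
    moreover have "D r * (exp (- (4 * K) / (1 + r)) * (4 * K / (1 + r)\<^sup>2)) + (a + b) * exp (- (4 * K) / (1 + r))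
        = (a + b + D r * (4 * K / (1 + r)\<^sup>2)) * exp (- (4 * K) / (1 + r))"
      by (simp add: algebra_simps)
    ultimately show ?thesis using nn by (metis exp_ge_zero mult_nonneg_nonneg)
  qed
  moreover have "(F \<longlongrightarrow> 0) at_top"
  proof (rule Lim_null_comparison)
    show "\<forall>\<^sub>F r in at_top. norm (F r) \<le> 8 * C\<^sup>2 * inverse r"
      using eventually_ge_at_top[of 1]
    proof eventually_elim
      case (elim r)
      have cube: "norm (\<gamma> r) ^ 3 \<ge> r"
      proof -
        have "r \<le> (1 + r)\<^sup>2" using elim by (simp add: power2_eq_square algebra_simps)
        also have "\<dots> \<le> norm (\<gamma> r) ^ 2 * 2" using n2[of r] elim by simp
        also have "\<dots> \<le> norm (\<gamma> r) ^ 2 * norm (\<gamma> r)" using n1[of r] C by (intro mult_left_mono) auto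
        finally show ?thesis by (simp add: eval_nat_numeral)
      qed
      have \<gamma>S: "\<gamma> r \<in> S" using ray[of r] elim by (simp add: \<gamma>_def)
      have "norm (\<gamma> r) ^ 3 > 0" using cube elim by linarith
      then have "C / norm (\<gamma> r) ^ 3 \<le> C / r"
        using cube elim C by (intro divide_left_mono mult_pos_pos) auto
      then have "norm (U r) \<le> 2 * (C / r)" "norm (V r) \<le> 2 * (C / r)"
        using sol \<gamma>S norm_triangle_ineq4[of "\<phi>1 (\<gamma> r)" "\<phi>2 (\<gamma> r)"] norm_triangle_ineq4[of "\<psi>1 (\<gamma> r)" "\<psi>2 (\<gamma> r)"]
        unfolding decaying_solution_def U_def V_def by (smt (verit))+
      then have "D r \<le> (2 * (C / r))\<^sup>2 + (2 * (C / r))\<^sup>2"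
        unfolding D_def by (intro add_mono power_mono) auto
      also have "\<dots> = 8 * C\<^sup>2 * (1 / r) ^ 2" by (simp add: power_divide)
      also have "\<dots> \<le> 8 * C\<^sup>2 * (1 / r) ^ 1" using elim by (intro mult_left_mono power_decreasing) auto
      finally have "D r \<le> 8 * C\<^sup>2 * inverse r" by (simp add: divide_inverse)
      moreover have "norm (F r) \<le> D r"
        using K0 elim D0[of r] by (simp add: F_def abs_mult mult_left_le)
      ultimately show ?case by linarith
    qed
    show "((\<lambda>r. 8 * C\<^sup>2 * inverse r) \<longlongrightarrow> 0) at_top"
      by (intro tendsto_mult_right_zero tendsto_inverse_0_at_top filterlim_ident)
  qed
  ultimately have "F 0 \<le> 0"
    by (rule nonpos_if_deriv_nonneg_tendsto_0[where a = 0]) auto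
  then have "D 0 \<le> 0" by (simp add: F_def mult_le_0_iff not_le)
  then have "U 0 = 0 \<and> V 0 = 0"
    unfolding D_def by (smt (verit) norm_eq_zero power_eq_0_iff zero_le_power2)
  then show ?thesis by (simp add: U_def V_def \<gamma>_def)
qed


text \<open>On s = -ir the energies \<open>A\<close> and \<open>B\<close> have linear rates 2(1/r -
  1) and 2(1/r + 1). The growing energy \<open>B\<close> is first dominated by \<open>A\<close>,
  since otherwise it could not tend to 0. This leaves a scalar inequality for \<open>A\<close>, in
  which the limit hypothesis supplies the boundary value at infinity.\<close>

lemma decaying_solutions_coincide_if_Stokes_zero:
  fixes C y y0 :: real
  assumes sol: "decaying_solution C S \<phi>1 \<psi>1" "decaying_solution C S \<phi>2 \<psi>2"
    and C: "C \<ge> 1" and axis: "\<And>y. y \<ge> y0 \<Longrightarrow> Complex 0 (- y) \<in> S"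
    and lim: "((\<lambda>y. inverse (Complex 0 (- y)) * exp (\<i> * Complex 0 (- y)) *
        (\<phi>1 (Complex 0 (- y)) - \<phi>2 (Complex 0 (- y)))) \<longlongrightarrow> 0) at_top"
    and y: "y \<ge> y0" "y \<ge> 132 * C\<^sup>2"
  shows "\<phi>1 (Complex 0 (- y)) = \<phi>2 (Complex 0 (- y)) \<and> \<psi>1 (Complex 0 (- y)) = \<psi>2 (Complex 0 (- y))"
proof -
  define \<gamma> where "\<gamma> r = Complex 0 (- r)" for r
  define U where "U = (\<lambda>r. \<phi>1 (\<gamma> r) - \<phi>2 (\<gamma> r))"
  define V where "V = (\<lambda>r. \<psi>1 (\<gamma> r) - \<psi>2 (\<gamma> r))"
  define A where "A = (\<lambda>r. (norm (U r))\<^sup>2)"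
  define B where "B = (\<lambda>r. (norm (V r))\<^sup>2)"
  define K where "K = 66 * C\<^sup>2"
  \<comment> \<open>Beyond \<open>2 * K\<close>, which is at least 132, one has 1/r \<le> 1/2 and
    2K/r^2 \<le> 1. The rates of \<open>A\<close> and \<open>B\<close> are then at most -1 and at
    least 1, enough to absorb the coupling errors in the derivative of \<open>B - A\<close>.\<close>
  define z where "z = max y0 (2 * K)"
  have C2: "C \<le> C\<^sup>2" "1 \<le> C\<^sup>2" using C by (auto simp: power2_eq_square intro: order_trans[OF C])
  have K0: "K \<ge> 66" using C2 by (simp add: K_def)
  have zK: "r \<ge> y0 \<and> r \<ge> 2 * K \<and> r \<ge> 132 \<and> r \<ge> 2 * C" if "r \<ge> z" for r
    using that K0 C2 unfolding z_def K_def by auto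
  have yz: "y \<ge> z" using y by (simp add: z_def K_def)
  have AB0: "A r \<ge> 0" "B r \<ge> 0" for r by (simp_all add: A_def B_def)
  have nrm: "norm (\<gamma> r) = \<bar>r\<bar>" for r by (simp add: \<gamma>_def cmod_def)
  have \<gamma>i: "\<gamma> r = - \<i> * complex_of_real r" for r by (simp add: \<gamma>_def complex_eq_iff)
  have \<gamma>S: "\<gamma> r \<in> S" if "r \<ge> z" for r using axis zK[OF that] by (simp add: \<gamma>_def)
  have der: "\<exists>a b. (A has_real_derivative a) (at r) \<and> (B has_real_derivative b) (at r) \<and>
      \<bar>a - 2 * (1 / r - 1) * A r\<bar> \<le> K / r\<^sup>2 * (A r + B r) \<and>
      \<bar>b - 2 * (1 / r + 1) * B r\<bar> \<le> K / r\<^sup>2 * (A r + B r)" if r: "r \<ge> z" for r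
  proof -
    have \<gamma>': "(\<gamma> has_vector_derivative - \<i>) (at r)"
      unfolding \<gamma>i[abs_def]
      by (auto intro!: derivative_eq_intros simp: has_vector_derivative_def scaleR_conv_of_real)
    have large: "2 * C \<le> norm (\<gamma> r)" using zK[OF r] by (simp add: nrm)
    have v1: "norm (- \<i>) = 1" by simp
    have rp: "r > 0" using zK[OF r] by simp
    have inv: "1 / \<gamma> r = \<i> / complex_of_real r" using rp by (simp add: \<gamma>i field_simps)
    have re: "Re (- (- \<i>) * (\<i> - 1 / \<gamma> r)) = 1 / r - 1" "Re (- \<i> * (\<i> + 1 / \<gamma> r)) = 1 / r + 1"
      unfolding inv using rp by (simp_all add: Re_divide Im_divide power2_eq_square)
    obtain a b where "(A has_real_derivative a) (at r)" "(B has_real_derivative b) (at r)"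
      "\<bar>a - 2 * Re (- (- \<i>) * (\<i> - 1 / \<gamma> r)) * A r\<bar> \<le> 66 * C\<^sup>2 / norm (\<gamma> r) ^ 2 * (A r + B r)"
      "\<bar>b - 2 * Re (- \<i> * (\<i> + 1 / \<gamma> r)) * B r\<bar> \<le> 66 * C\<^sup>2 / norm (\<gamma> r) ^ 2 * (A r + B r)"
      using difference_energy_derivatives[OF sol C \<gamma>S[OF r] large \<gamma>' v1]
      unfolding A_def B_def U_def V_def by blast
    then show ?thesis unfolding re nrm power2_abs K_def by blast
  qed
  have Kr: "2 * (K / r\<^sup>2) \<le> 1" if r: "r \<ge> z" for r
  proof -
    have "2 * K * 1 \<le> r * r" using zK[OF r] K0 by (intro mult_mono) auto
    then show ?thesis using zK[OF r] by (simp add: field_simps power2_eq_square)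
  qed
  have r1: "1 / r \<le> 1 / 2" "1 / r \<ge> 0" if r: "r \<ge> z" for r
    using zK[OF r] by (auto simp: field_simps)
  have UV: "norm (U r) \<le> 2 * (C / r)" "norm (V r) \<le> 2 * (C / r)" if r: "r \<ge> z" for r
  proof -
    have "r ^ 1 \<le> r ^ 3" using zK[OF r] by (intro power_increasing) auto
    then have "C / norm (\<gamma> r) ^ 3 \<le> C / r"
      using zK[OF r] C by (intro divide_left_mono) (auto simp: nrm)
    then show "norm (U r) \<le> 2 * (C / r)" "norm (V r) \<le> 2 * (C / r)"
      using sol \<gamma>S[OF r] norm_triangle_ineq4[of "\<phi>1 (\<gamma> r)" "\<phi>2 (\<gamma> r)"] norm_triangle_ineq4[of "\<psi>1 (\<gamma> r)" "\<psi>2 (\<gamma> r)"]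
      unfolding decaying_solution_def U_def V_def by (smt (verit))+
  qed
  have inv0: "((\<lambda>r. 2 * (C / r)) \<longlongrightarrow> 0) at_top"
    unfolding divide_inverse
    by (intro tendsto_mult_right_zero tendsto_inverse_0_at_top filterlim_ident)
  have "(U \<longlongrightarrow> 0) at_top" "(V \<longlongrightarrow> 0) at_top"
    by (rule Lim_null_comparison[OF eventually_mono[OF eventually_ge_at_top[of z]] inv0], use UV in blast)+
  then have limAB: "(A \<longlongrightarrow> 0) at_top" "(B \<longlongrightarrow> 0) at_top"
    unfolding A_def B_def by (auto intro!: tendsto_eq_intros)
  \<comment> \<open>\<open>B - A\<close> is nondecreasing and tends to 0.\<close>
  have BA: "B r \<le> A r" if r: "r \<ge> z" for r
  proof -
    have "B r - A r \<le> 0"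
    proof (rule nonpos_if_deriv_nonneg_tendsto_0[where a = z and f = "\<lambda>r. B r - A r"])
      fix x assume x: "x \<ge> z"
      obtain a b where a: "(A has_real_derivative a) (at x)" and b: "(B has_real_derivative b) (at x)"
        and ab: "\<bar>a - 2 * (1 / x - 1) * A x\<bar> \<le> K / x\<^sup>2 * (A x + B x)"
          "\<bar>b - 2 * (1 / x + 1) * B x\<bar> \<le> K / x\<^sup>2 * (A x + B x)"
        using der[OF x] by blast
      have "2 * (1 / x - 1) * A x \<le> - 1 * A x" "2 * (1 / x + 1) * B x \<ge> 1 * B x"
        using r1[OF x] AB0 by (intro mult_right_mono; simp)+
      moreover have "2 * (K / x\<^sup>2) * (A x + B x) \<le> 1 * (A x + B x)"
        using Kr[OF x] AB0 by (intro mult_right_mono) auto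
      moreover have "b' - a' \<ge> 0" if "\<bar>a' - p\<bar> \<le> e * (A x + B x)" "\<bar>b' - q\<bar> \<le> e * (A x + B x)"
        "p \<le> - 1 * A x" "q \<ge> 1 * B x" "2 * e * (A x + B x) \<le> 1 * (A x + B x)" for a' b' p q e :: real
      proof -
        have "2 * (e * (A x + B x)) \<le> A x + B x" using that(5) by simp
        then show ?thesis using that(1-4) by linarith
      qed
      ultimately have "b - a \<ge> 0" using ab by blast
      then show "\<exists>D. ((\<lambda>r. B r - A r) has_real_derivative D) (at x) \<and> D \<ge> 0"
        using DERIV_diff[OF b a] by blast
    next
      show "((\<lambda>r. B r - A r) \<longlongrightarrow> 0) at_top" using tendsto_diff[OF limAB(2,1)] by simp
    qed (fact r)
    then show ?thesis by simp
  qed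
  \<comment> \<open>\<open>exp (2 * r) / r^2\<close> is the squared modulus of the Stokes factor at
    s = -ir. The last factor has logarithmic derivative 2K/r^2 and pays for the error in the rate of
    \<open>A\<close>, which is at most 2K/r^2 times \<open>A\<close> because
    \<open>B \<le> A\<close>.\<close>
  define E where "E r = exp (2 * r) / r\<^sup>2 * exp (- (2 * K) / r)" for r
  have "A y * E y \<le> 0"
  proof (rule nonpos_if_deriv_nonneg_tendsto_0[where a = z and f = "\<lambda>r. A r * E r"])
    fix x assume x: "x \<ge> z"
    have xp: "x > 0" using zK[OF x] by simp
    obtain a where a: "(A has_real_derivative a) (at x)"
      and ab: "\<bar>a - 2 * (1 / x - 1) * A x\<bar> \<le> K / x\<^sup>2 * (A x + B x)"
      using der[OF x] by blast
    have "K / x\<^sup>2 * (A x + B x) \<le> K / x\<^sup>2 * (2 * A x)"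
      using BA[OF x] K0 by (intro mult_left_mono) auto
    with ab have nn: "a + A x * (2 - 2 / x + 2 * K / x\<^sup>2) \<ge> 0" by (simp add: algebra_simps)
    have "(E has_real_derivative E x * (2 - 2 / x + 2 * K / x\<^sup>2)) (at x)"
      unfolding E_def using xp
      by (auto intro!: derivative_eq_intros simp: field_simps power2_eq_square)
    from DERIV_mult'[OF a this]
    have "((\<lambda>r. A r * E r) has_real_derivative (a + A x * (2 - 2 / x + 2 * K / x\<^sup>2)) * E x) (at x)"
      by (simp add: algebra_simps)
    moreover have "E x \<ge> 0" by (simp add: E_def)
    ultimately show "\<exists>D. ((\<lambda>r. A r * E r) has_real_derivative D) (at x) \<and> D \<ge> 0"
      using nn by (metis mult_nonneg_nonneg)
  next
    define G where "G r = inverse (\<gamma> r) * exp (\<i> * \<gamma> r) * U r" for r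
    have "(G \<longlongrightarrow> 0) at_top" using lim unfolding G_def[abs_def] U_def \<gamma>_def .
    then have G0: "((\<lambda>r. (norm (G r))\<^sup>2) \<longlongrightarrow> 0) at_top" by (auto intro!: tendsto_eq_intros)
    show "((\<lambda>r. A r * E r) \<longlongrightarrow> 0) at_top"
    proof (rule Lim_null_comparison[OF eventually_mono[OF eventually_ge_at_top[of z]] G0])
      fix r assume r: "z \<le> r"
      have "(norm (G r))\<^sup>2 = A r * (exp (2 * r) / r\<^sup>2)"
      proof -
        have "norm (exp (\<i> * \<gamma> r)) = exp r" by (simp add: \<gamma>_def)
        then show ?thesis
          unfolding G_def norm_mult norm_inverse nrm A_def
          by (simp add: power_mult_distrib power_inverse exp_double divide_inverse)
      qed
      then have "A r * E r = (norm (G r))\<^sup>2 * exp (- (2 * K) / r)" by (simp add: E_def)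
      moreover have "exp (- (2 * K) / r) \<le> 1" using zK[OF r] K0 by simp
      ultimately show "norm (A r * E r) \<le> (norm (G r))\<^sup>2"
        by (simp add: abs_mult mult_left_le)
    qed
  qed (fact yz)
  moreover have "E y > 0" using zK[OF yz] by (simp add: E_def)
  ultimately have "A y \<le> 0" by (simp add: mult_le_0_iff not_le)
  moreover from this have "B y \<le> 0" using BA[OF yz] by simp
  ultimately show ?thesis by (simp add: A_def B_def U_def V_def \<gamma>_def)
qed

section \<open>Reflection symmetry\<close>

text \<open>The two unknowns are X + iY and X - iY for a system with real coefficients, so
  conjugation exchanges them. In the formulas, conjugating \<i> changes its sign, and so does
  exchanging the unknowns in the difference of squares.\<close>

lemma decaying_solution_conjugate:
  assumes sol: "decaying_solution C S \<phi> \<psi>" and S: "\<And>s. s \<in> S \<Longrightarrow> cnj s \<in> S"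
  shows "decaying_solution C S (cnj \<circ> \<psi> \<circ> cnj) (cnj \<circ> \<phi> \<circ> cnj)"
proof -
  have fields: "inner_phi s (cnj b) (cnj a) = cnj (inner_psi (cnj s) a b)"
    "inner_psi s (cnj b) (cnj a) = cnj (inner_phi (cnj s) a b)" for s a b
    by (simp_all add: inner_phi_def inner_psi_def mult.commute mult.left_commute distrib_left right_diff_distrib)
  have "((\<lambda>s. cnj (f (cnj s))) has_field_derivative cnj f') (at s)"
    if "(f has_field_derivative f') (at (cnj s))" for f f' s
    using has_field_derivative_cnj_cnj[of f f' s] that by (simp add: o_def)
  note der = this
  have nz: "1 + s\<^sup>2 * cnj b * cnj a \<noteq> 0" if "1 + (cnj s)\<^sup>2 * a * b \<noteq> 0" for s a b
  proof -
    have "cnj (1 + (cnj s)\<^sup>2 * a * b) = 1 + s\<^sup>2 * cnj b * cnj a" by (simp add: mult.commute mult.left_commute)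
    then show ?thesis using that by (metis complex_cnj_zero_iff)
  qed
  have "solves_inner S (cnj \<circ> \<psi> \<circ> cnj) (cnj \<circ> \<phi> \<circ> cnj)"
    unfolding solves_inner_def
  proof
    fix s assume "s \<in> S"
    then have *: "cnj s \<noteq> 0 \<and> 1 + (cnj s)\<^sup>2 * \<phi> (cnj s) * \<psi> (cnj s) \<noteq> 0 \<and>
      (\<phi> has_field_derivative inner_phi (cnj s) (\<phi> (cnj s)) (\<psi> (cnj s))) (at (cnj s)) \<and>
      (\<psi> has_field_derivative inner_psi (cnj s) (\<phi> (cnj s)) (\<psi> (cnj s))) (at (cnj s))"
      using sol S[of s] unfolding decaying_solution_def solves_inner_def by blast
    show "s \<noteq> 0 \<and> 1 + s\<^sup>2 * (cnj \<circ> \<psi> \<circ> cnj) s * (cnj \<circ> \<phi> \<circ> cnj) s \<noteq> 0 \<and>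
      (cnj \<circ> \<psi> \<circ> cnj has_field_derivative inner_phi s ((cnj \<circ> \<psi> \<circ> cnj) s) ((cnj \<circ> \<phi> \<circ> cnj) s)) (at s) \<and>
      (cnj \<circ> \<phi> \<circ> cnj has_field_derivative inner_psi s ((cnj \<circ> \<psi> \<circ> cnj) s) ((cnj \<circ> \<phi> \<circ> cnj) s)) (at s)"
      using * der[of \<psi> _ s] der[of \<phi> _ s] nz[of s] by (simp add: fields o_def)
  qed
  moreover have "norm ((cnj \<circ> \<psi> \<circ> cnj) s) \<le> C / norm s ^ 3 \<and> norm ((cnj \<circ> \<phi> \<circ> cnj) s) \<le> C / norm s ^ 3"
    if "s \<in> S" for s
    using sol S[OF that] unfolding decaying_solution_def comp_apply complex_mod_cnj
    by (metis complex_mod_cnj)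
  ultimately show ?thesis by (simp add: decaying_solution_def)
qed

section \<open>Factorial growth of the formal solution\<close>

text \<open>This is log-convexity of the factorial: for a fixed sum of arguments the product is
  largest when they are furthest apart.\<close>

lemma fact_mult_fact_le:
  assumes "p \<le> q"
  shows "fact (p + k) * fact q \<le> (fact p * fact (q + k) :: real)"
proof (induction k)
  case (Suc k)
  have "fact (p + Suc k) * fact q = real (p + Suc k) * (fact (p + k) * fact q)" by simp
  also have "\<dots> \<le> real (q + Suc k) * (fact p * fact (q + k))"
    using assms by (intro mult_mono[OF _ Suc]) auto
  also have "\<dots> = fact p * fact (q + Suc k)" by simp
  finally show ?case .
qed simp

text \<open>Series starting at order p leave only m + 1 - 2p terms in the convolution, each maximal
  at an end of the range. Since every index that occurs satisfies \<open>j + p \<le> m\<close>,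
  bounds are required only that far; this makes the estimate usable inside an induction on the
  order.\<close>

lemma norm_fps_mult_nth_le_fact:
  fixes A B :: "complex fps" and a b :: real
  assumes A0: "\<And>j. j < p \<Longrightarrow> fps_nth A j = 0" and B0: "\<And>j. j < p \<Longrightarrow> fps_nth B j = 0"
    and A: "\<And>j. p \<le> j \<Longrightarrow> j + p \<le> m \<Longrightarrow> norm (fps_nth A j) \<le> a * fact j"
    and B: "\<And>j. p \<le> j \<Longrightarrow> j + p \<le> m \<Longrightarrow> norm (fps_nth B j) \<le> b * fact j"
    and ab: "a \<ge> 0" "b \<ge> 0"
  shows "m < 2 * p \<Longrightarrow> fps_nth (A * B) m = 0"
    and "norm (fps_nth (A * B) m) \<le> a * b * real (m + 1 - 2 * p) * fact p * fact (m - p)"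
proof -
  have z: "fps_nth A j * fps_nth B (m - j) = 0" if "j \<in> {0..m} - {p..m - p}" for j
  proof -
    have "j < p \<or> m - j < p" using that by auto
    then show ?thesis using A0 B0 by auto
  qed
  show zero: "fps_nth (A * B) m = 0" if "m < 2 * p"
    unfolding fps_mult_nth using that by (intro sum.neutral ballI z) auto
  show "norm (fps_nth (A * B) m) \<le> a * b * real (m + 1 - 2 * p) * fact p * fact (m - p)"
  proof (cases "m < 2 * p")
    case False
    have "fps_nth (A * B) m = (\<Sum>j\<in>{p..m - p}. fps_nth A j * fps_nth B (m - j))"
      unfolding fps_mult_nth using z by (intro sum.mono_neutral_right) auto
    also have "norm \<dots> \<le> real (card {p..m - p}) * (a * b * (fact p * fact (m - p)))"
    proof (rule sum_norm_bound)
      fix j assume j: "j \<in> {p..m - p}"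
      have "norm (fps_nth A j * fps_nth B (m - j)) \<le> (a * fact j) * (b * fact (m - j))"
        unfolding norm_mult using j ab False by (intro mult_mono A B) auto
      also have "\<dots> = a * b * (fact j * fact (m - j))" by simp
      also have "\<dots> \<le> a * b * (fact p * fact (m - p))"
        using fact_mult_fact_le[of p "m - j" "j - p"] j ab False by (intro mult_left_mono) auto
      finally show "norm (fps_nth A j * fps_nth B (m - j)) \<le> a * b * (fact p * fact (m - p))" .
    qed
    also have "\<dots> = a * b * real (m + 1 - 2 * p) * fact p * fact (m - p)"
    proof -
      have "card {p..m - p} = m + 1 - 2 * p" using False by simp
      then show ?thesis by (simp only: mult_ac)
    qed
    finally show ?thesis .
  qed (use zero ab in simp)
qed

text \<open>At orders 0 and 1 the truncated difference makes the factor 0, so the formula holds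
  without exception.\<close>

lemma fps_X_power2_mult_deriv_nth:
  "fps_nth (fps_X ^ 2 * fps_deriv A) n = of_nat (n - 1) * fps_nth A (n - 1)" for A :: "complex fps"
proof (cases "n < 2")
  case True
  then have "n = 0 \<or> n = 1" by auto
  then show ?thesis by (auto simp: fps_X_power_mult_nth)
next
  case False
  then obtain k where "n = k + 2" by (metis add.commute le_Suc_ex not_less)
  then show ?thesis by (simp add: fps_X_power_mult_nth)
qed

text \<open>In the variable z = 1/s the derivative becomes -z^2 d/dz, which contributes n - 1 times
  the previous coefficient; the term \<open>- fps_X * A\<close> contributes one more. The resulting
  factor n is the source of the factorial growth.\<close>

lemma inner_equation_coeff_recursion:
  fixes A H K P :: "complex fps"
  assumes eq: "(1 + P) * (fps_X ^ 2 * fps_deriv A)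
      = (fps_const c - fps_X) * A + fps_X ^ 3 - fps_const (\<i> / 2) * fps_X * (H ^ 2 - K ^ 2)"
    and n: "n \<ge> 1"
  shows "c * fps_nth A n = of_nat n * fps_nth A (n - 1) - (if n = 3 then 1 else 0)
      + fps_nth (P * (fps_X ^ 2 * fps_deriv A)) n + \<i> / 2 * (fps_nth (H * H) (n - 1) - fps_nth (K * K) (n - 1))"
proof -
  have "fps_nth ((1 + P) * (fps_X ^ 2 * fps_deriv A)) n
      = of_nat (n - 1) * fps_nth A (n - 1) + fps_nth (P * (fps_X ^ 2 * fps_deriv A)) n"
    by (simp only: distrib_right mult_1 fps_add_nth fps_X_power2_mult_deriv_nth)
  moreover have "fps_nth ((fps_const c - fps_X) * A + fps_X ^ 3 - fps_const (\<i> / 2) * fps_X * (H ^ 2 - K ^ 2)) n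
      = c * fps_nth A n - fps_nth A (n - 1) + (if n = 3 then 1 else 0)
        - \<i> / 2 * (fps_nth (H * H) (n - 1) - fps_nth (K * K) (n - 1))"
    using n by (simp add: left_diff_distrib mult.assoc power2_eq_square[of H] power2_eq_square[of K])
  ultimately have "of_nat (n - 1) * fps_nth A (n - 1) + fps_nth (P * (fps_X ^ 2 * fps_deriv A)) n
      = c * fps_nth A n - fps_nth A (n - 1) + (if n = 3 then 1 else 0)
        - \<i> / 2 * (fps_nth (H * H) (n - 1) - fps_nth (K * K) (n - 1))"
    unfolding eq by simp
  moreover have "of_nat (n - 1) * fps_nth A (n - 1) = of_nat n * fps_nth A (n - 1) - fps_nth A (n - 1)"
    using n by (simp add: of_nat_diff left_diff_distrib)
  ultimately show ?thesis
    by (simp only: diff_eq_eq eq_diff_eq add_diff_eq diff_add_eq diff_diff_eq2 ac_simps add_left_cancel)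
qed


text \<open>Products of \<open>H\<close> and \<open>K\<close> start at order 6, so the shifted
  product and \<open>fps_X ^ 2 * fps_deriv A\<close> both start at order 4. Hence the cubic
  contribution starts at order 8 and the quadratic one, multiplied by one more \<open>fps_X\<close>,
  at order 7. These gaps turn bounds of size j! into (n-3)!.\<close>

lemma norm_nonlinear_coeff_le:
  fixes H K A :: "complex fps"
  assumes H0: "\<And>j. j < 3 \<Longrightarrow> fps_nth H j = 0" and K0: "\<And>j. j < 3 \<Longrightarrow> fps_nth K j = 0"
    and A: "A = H \<or> A = K"
    and Hb: "\<And>j. j < n \<Longrightarrow> norm (fps_nth H j) \<le> 1 / 4 * fact j"
    and Kb: "\<And>j. j < n \<Longrightarrow> norm (fps_nth K j) \<le> 1 / 4 * fact j"
    and n: "n \<ge> 3"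
  defines "E \<equiv> fps_nth (fps_shift 2 (H * K) * (fps_X ^ 2 * fps_deriv A)) n
      + \<i> / 2 * (fps_nth (H * H) (n - 1) - fps_nth (K * K) (n - 1))"
  shows "n < 7 \<Longrightarrow> E = 0" and "norm E \<le> 21 / 8 * fact (n - 3)"
proof -
  have quad0: "fps_nth (F * G) m = 0" if "F \<in> {H, K}" "G \<in> {H, K}" "m < 6" for F G m
    using that H0 K0 by (intro norm_fps_mult_nth_le_fact(1)[where p = 3 and a = 0 and b = 0]) auto
  \<comment> \<open>The range of \<open>m\<close> may exceed \<open>n\<close>: both factors start at
    order 3, so only indices up to m - 3 < n occur. The number m - 5 of terms is absorbed by passing
    from (m-3)! to (m-2)!, and 3/8 = 3!/16.\<close>
  have quad: "norm (fps_nth (F * G) m) \<le> 3 / 8 * fact (m - 2)"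
    if FG: "F \<in> {H, K}" "G \<in> {H, K}" and m: "m < n + 3" for F G m
  proof (cases "m < 6")
    case False
    then obtain k where k: "m = k + 6" by (metis add.commute le_Suc_ex not_less)
    have "norm (fps_nth (F * G) m) \<le> 1 / 4 * (1 / 4) * real (m + 1 - 2 * 3) * fact 3 * fact (m - 3)"
      using FG m H0 K0 Hb Kb by (intro norm_fps_mult_nth_le_fact(2)) auto
    also have "\<dots> = 3 / 8 * (real (m - 5) * fact (m - 3))" by (simp add: fact_numeral)
    also have "\<dots> \<le> 3 / 8 * (real (m - 2) * fact (m - 3))"
      by (intro mult_left_mono mult_right_mono) auto
    also have "real (m - 2) * fact (m - 3) = (fact (m - 2) :: real)"
    proof -
      have "m - 2 = Suc (m - 3)" using k by simp
      then show ?thesis by (simp only: fact_Suc)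
    qed
    finally show ?thesis .
  qed (use quad0[OF FG] in simp)
  define P where "P = fps_shift 2 (H * K)"
  define Q where "Q = fps_X ^ 2 * fps_deriv A"
  have Pn: "fps_nth P j = fps_nth (H * K) (j + 2)" for j by (simp add: P_def)
  have P0: "fps_nth P j = 0" if "j < 4" for j using that quad0[of H K "j + 2"] by (simp add: Pn)
  have Q_nth: "fps_nth Q j = of_nat (j - 1) * fps_nth A (j - 1)" for j
    unfolding Q_def by (rule fps_X_power2_mult_deriv_nth)
  have Q0: "fps_nth Q j = 0" if "j < 4" for j using that A H0 K0 by (auto simp: Q_nth)
  have Pb: "norm (fps_nth P j) \<le> 3 / 8 * fact j" if "j + 4 \<le> n" for j
    using quad[of H K "j + 2"] that by (simp add: Pn)
  have Qb: "norm (fps_nth Q j) \<le> 1 / 4 * fact j" if "j + 4 \<le> n" "j \<ge> 4" for j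
  proof -
    have "norm (fps_nth A (j - 1)) \<le> 1 / 4 * fact (j - 1)" using A Hb Kb that by auto
    then have "real (j - 1) * norm (fps_nth A (j - 1)) \<le> real j * (1 / 4 * fact (j - 1))"
      by (intro mult_mono) auto
    also have "\<dots> = 1 / 4 * fact j" using that by (simp add: fact_reduce[of j])
    finally show ?thesis unfolding Q_nth norm_mult norm_of_nat .
  qed
  have PQ0: "fps_nth (P * Q) n = 0" if "n < 8"
    using that P0 Q0 by (intro norm_fps_mult_nth_le_fact(1)[where p = 4 and a = 0 and b = 0]) auto
  \<comment> \<open>9/4 = 3/8 * 1/4 * 4!. Adding 3/8 from the quadratic terms gives 21/8.\<close>
  have PQ: "norm (fps_nth (P * Q) n) \<le> 9 / 4 * fact (n - 3)"
  proof (cases "n < 8")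
    case False
    have "norm (fps_nth (P * Q) n) \<le> 3 / 8 * (1 / 4) * real (n + 1 - 2 * 4) * fact 4 * fact (n - 4)"
      using P0 Q0 Pb Qb by (intro norm_fps_mult_nth_le_fact(2)) auto
    also have "\<dots> = 9 / 4 * (real (n - 7) * fact (n - 4))" by (simp add: fact_numeral)
    also have "\<dots> \<le> 9 / 4 * (real (n - 3) * fact (n - 4))"
      by (intro mult_left_mono mult_right_mono) auto
    also have "real (n - 3) * fact (n - 4) = (fact (n - 3) :: real)"
    proof -
      have "n - 3 = Suc (n - 4)" using False by simp
      then show ?thesis by (simp only: fact_Suc)
    qed
    finally show ?thesis .
  qed (use PQ0 in simp)
  show "E = 0" if "n < 7"
    using that PQ0 quad0[of H H "n - 1"] quad0[of K K "n - 1"] by (simp add: E_def P_def Q_def)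
  have "norm (\<i> / 2 * (fps_nth (H * H) (n - 1) - fps_nth (K * K) (n - 1))) \<le> 3 / 8 * fact (n - 3)"
  proof -
    have "n - 1 - 2 = n - 3" "n - 1 < n + 3" using n by simp_all
    then have "norm (fps_nth (H * H) (n - 1)) \<le> 3 / 8 * fact (n - 3)"
      "norm (fps_nth (K * K) (n - 1)) \<le> 3 / 8 * fact (n - 3)"
      using quad[of H H "n - 1"] quad[of K K "n - 1"] by (simp_all only: insert_iff simp_thms)
    moreover have "norm (\<i> / 2 * d) = norm d / 2" for d by (simp add: norm_mult norm_divide)
    ultimately show ?thesis
      using norm_triangle_ineq4[of "fps_nth (H * H) (n - 1)" "fps_nth (K * K) (n - 1)"]
      by simp
  qed
  then show "norm E \<le> 21 / 8 * fact (n - 3)"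
    using PQ norm_triangle_ineq[of "fps_nth (P * Q) n" "\<i> / 2 * (fps_nth (H * H) (n - 1) - fps_nth (K * K) (n - 1))"]
    unfolding E_def P_def Q_def by linarith
qed


text \<open>A bootstrap: as long as the normalized coefficients |a_j|/j! remain within 1/20 of 1/6
  they are below 1/4, which bounds the perturbation strongly enough to keep the next one in the same
  window. The window also lies above 1/12.\<close>

lemma inner_equation_coeff_growth:
  fixes H K :: "complex fps"
  defines "P \<equiv> fps_shift 2 (H * K)"
  assumes eqH: "(1 + P) * (fps_X ^ 2 * fps_deriv H)
      = (fps_const \<i> - fps_X) * H + fps_X ^ 3 - fps_const (\<i> / 2) * fps_X * (H ^ 2 - K ^ 2)"
    and eqK: "(1 + P) * (fps_X ^ 2 * fps_deriv K)
      = (fps_const (- \<i>) - fps_X) * K + fps_X ^ 3 - fps_const (\<i> / 2) * fps_X * (H ^ 2 - K ^ 2)"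
    and H0: "fps_nth H 0 = 0" and K0: "fps_nth K 0 = 0" and n: "n \<ge> 3"
  shows "norm (fps_nth H n) \<ge> fact n / 12"
proof -
  define E where "E A n = fps_nth (P * (fps_X ^ 2 * fps_deriv A)) n
    + \<i> / 2 * (fps_nth (H * H) (n - 1) - fps_nth (K * K) (n - 1))" for A :: "complex fps" and n
  have rec: "\<exists>c. norm c = 1 \<and> (\<forall>n\<ge>1. c * fps_nth A n = of_nat n * fps_nth A (n - 1) - (if n = 3 then 1 else 0) + E A n)"
    if "A \<in> {H, K}" for A
  proof -
    have "\<forall>n\<ge>1. \<i> * fps_nth H n = of_nat n * fps_nth H (n - 1) - (if n = 3 then 1 else 0) + E H n"
      using inner_equation_coeff_recursion[OF eqH] unfolding E_def add.assoc by blast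
    moreover have "\<forall>n\<ge>1. (- \<i>) * fps_nth K n = of_nat n * fps_nth K (n - 1) - (if n = 3 then 1 else 0) + E K n"
      using inner_equation_coeff_recursion[OF eqK] unfolding E_def add.assoc by blast
    moreover have "norm \<i> = 1" "norm (- \<i>) = 1" by simp_all
    ultimately show ?thesis using that by blast
  qed
  \<comment> \<open>The estimate of the nonlinear terms presupposes series starting at order 3, so
    orders 1 and 2 are computed directly; the forcing enters only at order 3.\<close>
  have A1: "fps_nth A 1 = 0" if A: "A \<in> {H, K}" for A
  proof -
    obtain c where c: "norm c = 1" "c * fps_nth A 1 = fps_nth A 0 + E A 1"
      using rec[OF A] by force
    moreover have "E A 1 = 0"
      by (simp add: E_def fps_mult_nth[of P] fps_X_power2_mult_deriv_nth fps_mult_nth[of H] fps_mult_nth[of K] H0 K0)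
    ultimately show ?thesis using that H0 K0 by auto
  qed
  have A2: "fps_nth A 2 = 0" if A: "A \<in> {H, K}" for A
  proof -
    obtain c where c: "norm c = 1" "c * fps_nth A 2 = of_nat 2 * fps_nth A 1 + E A 2"
      using rec[OF A] by force
    moreover have "E A 2 = 0"
    proof -
      have "fps_nth (fps_X ^ 2 * fps_deriv A) j = 0" if "j \<le> 2" for j
        using that A1[OF A] by (cases "j = 2") (auto simp: fps_X_power2_mult_deriv_nth)
      then have "fps_nth (P * (fps_X ^ 2 * fps_deriv A)) 2 = 0"
        unfolding fps_mult_nth[of P] by (intro sum.neutral) auto
      then show ?thesis by (simp add: E_def fps_mult_nth[of H] fps_mult_nth[of K] H0 K0)
    qed
    ultimately show ?thesis using A1[OF A] by auto
  qed
  have low: "fps_nth H j = 0" "fps_nth K j = 0" if "j < 3" for j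
  proof -
    have "j = 0 \<or> j = 1 \<or> j = 2" using that by auto
    then show "fps_nth H j = 0" "fps_nth K j = 0" using H0 K0 A1 A2 by auto
  qed
  \<comment> \<open>The tolerance starts at 0 for \<open>n \<le> 6\<close>, and its increments telescope to dominate the
    perturbations \<open>21 / 8 * fact (n - 3) / fact n\<close>.\<close>
  define \<tau> where "\<tau> n = 1 / 20 - 3 / 2 / (real (max n 6) * (real (max n 6) - 1))" for n
  have \<tau>: "\<tau> n \<le> 1 / 20" for n by (simp add: \<tau>_def)
  \<comment> \<open>Both series are carried through one induction because the perturbation of each
    involves \<open>H\<close> and \<open>K\<close>.\<close>
  have main: "A \<in> {H, K} \<Longrightarrow> n \<ge> 3 \<Longrightarrow> \<bar>norm (fps_nth A n) / fact n - 1 / 6\<bar> \<le> \<tau> n" for A n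
  proof (induction n arbitrary: A rule: less_induct)
    case (less n)
    have b: "norm (fps_nth B j) \<le> 1 / 4 * fact j" if "B \<in> {H, K}" "j < n" for B j
    proof (cases "j < 3")
      case False
      then have "norm (fps_nth B j) / fact j \<le> 1 / 4"
        using less.IH[OF that(2,1)] \<tau>[of j] by linarith
      then show ?thesis by (simp add: field_simps)
    qed (use that low in auto)
    have E: "n < 7 \<Longrightarrow> E A n = 0" "norm (E A n) \<le> 21 / 8 * fact (n - 3)"
      using norm_nonlinear_coeff_le[of H K A n] low b less.prems unfolding E_def P_def by auto
    obtain c where c: "norm c = 1"
      and r: "c * fps_nth A n = of_nat n * fps_nth A (n - 1) - (if n = 3 then 1 else 0) + E A n"
      using rec[OF less.prems(1)] less.prems(2) by force
    show ?case
    proof (cases "n = 3")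
      case True
      then have "c * fps_nth A 3 = - 1" using r E(1) A2[OF less.prems(1)] by simp
      then have "norm c * norm (fps_nth A 3) = 1" by (metis norm_minus_cancel norm_mult norm_one)
      then show ?thesis using c True by (simp add: \<tau>_def fact_numeral)
    next
      case False
      define x where "x = norm (fps_nth A n) / fact n"
      define y where "y = norm (fps_nth A (n - 1)) / fact (n - 1)"
      have n4: "n \<ge> 4" using False less.prems by simp
      have IH: "\<bar>y - 1 / 6\<bar> \<le> \<tau> (n - 1)" using less.IH[of "n - 1" A] n4 less.prems by (simp add: y_def)
      have fn: "fact n = real n * fact (n - 1)" using n4 by (simp add: fact_reduce)
      have "norm (fps_nth A n) = norm (of_nat n * fps_nth A (n - 1) + E A n)"
      proof -
        have "c * fps_nth A n = of_nat n * fps_nth A (n - 1) + E A n" using r False by simp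
        then have "norm c * norm (fps_nth A n) = norm (of_nat n * fps_nth A (n - 1) + E A n)"
          by (simp only: norm_mult[symmetric])
        then show ?thesis by (simp only: c mult_1)
      qed
      then have "\<bar>norm (fps_nth A n) - real n * norm (fps_nth A (n - 1))\<bar> \<le> norm (E A n)"
        using norm_triangle_ineq[of "of_nat n * fps_nth A (n - 1)" "E A n"]
          norm_diff_ineq[of "of_nat n * fps_nth A (n - 1)" "E A n"] by (simp add: norm_mult)
      then have "\<bar>norm (fps_nth A n) - real n * norm (fps_nth A (n - 1))\<bar> / fact n \<le> norm (E A n) / fact n"
        by (intro divide_right_mono) auto
      moreover have "x - y = (norm (fps_nth A n) - real n * norm (fps_nth A (n - 1))) / fact n"
        using n4 by (simp add: x_def y_def fn diff_divide_distrib)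
      ultimately have xy: "\<bar>x - y\<bar> \<le> norm (E A n) / fact n" by simp
      show ?thesis
      proof (cases "n < 7")
        case True
        then have "\<tau> n = \<tau> (n - 1)" by (simp add: \<tau>_def max_def)
        then show ?thesis using xy E(1)[OF True] IH by (simp add: x_def)
      next
        case False
        define t where "t = real n"
        have t: "t \<ge> 7" using False by (simp add: t_def)
        have "fact n = t * (t - 1) * (t - 2) * fact (n - 3)"
        proof -
          obtain k where "n = k + 3" using less.prems(2) by (metis add.commute le_Suc_ex)
          then have "n = Suc (Suc (Suc k))" by simp
          then show ?thesis by (simp add: t_def algebra_simps)
        qed
        then have "norm (E A n) / fact n \<le> 21 / 8 * fact (n - 3) / (t * (t - 1) * (t - 2) * fact (n - 3))"
          using divide_right_mono[OF E(2) fact_ge_zero[of n]] by simp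
        also have "\<dots> = 21 / 8 / (t * (t - 1) * (t - 2))" by simp
        \<comment> \<open>Rounding 21/8 up to 3, twice the 3/2 in \<open>\<tau>\<close>, makes the
          bound by partial fractions exactly one increment of \<open>\<tau>\<close>.\<close>
        also have "\<dots> \<le> 3 / (t * (t - 1) * (t - 2))"
          using t by (intro divide_right_mono) auto
        also have "\<dots> = 3 / 2 / ((t - 1) * (t - 2)) - 3 / 2 / (t * (t - 1))"
        proof -
          have "3 / 2 / (a * b) - 3 / 2 / (t * a) = 3 / 2 * (t - b) / (t * a * b)" if "a \<noteq> 0" "b \<noteq> 0" for a b
            using that t by (simp add: field_simps)
          from this[of "t - 1" "t - 2"] show ?thesis using t by simp
        qed
        also have "\<dots> = \<tau> n - \<tau> (n - 1)"
        proof -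
          have "max n 6 = n" "max (n - 1) 6 = n - 1" "real (n - 1) = t - 1"
            using False by (auto simp: t_def)
          then show ?thesis by (simp add: \<tau>_def t_def[symmetric])
        qed
        finally show ?thesis using xy IH unfolding x_def by linarith
      qed
    qed
  qed
  have "norm (fps_nth H n) / fact n \<ge> 1 / 12" using main[OF insertI1 n] \<tau>[of n] by linarith
  then show ?thesis by (simp add: field_simps)
qed

text \<open>Inside a positive radius r both a_n r^n and r^(-n)/n! tend to 0, and the modulus of
  their product is |a_n|/n!.\<close>

lemma fps_conv_radius_0_if_factorial_growth:
  fixes H :: "complex fps"
  assumes "c > 0" and growth: "\<And>n. n \<ge> N \<Longrightarrow> norm (fps_nth H n) \<ge> c * fact n"
  shows "fps_conv_radius H = 0"
proof (rule ccontr)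
  assume "fps_conv_radius H \<noteq> 0"
  moreover have "fps_conv_radius H \<ge> 0" by (simp add: fps_conv_radius_def conv_radius_nonneg)
  ultimately have "0 < fps_conv_radius H" by (simp add: order_less_le)
  from ereal_dense2[OF this] obtain r where r: "0 < r" "ereal r < fps_conv_radius H"
    by auto
  have "summable (\<lambda>n. norm (fps_nth H n * complex_of_real r ^ n))"
    using r by (intro norm_summable_fps) simp
  from tendsto_mult[OF summable_LIMSEQ_zero[OF this] summable_LIMSEQ_zero[OF summable_exp[of "1 / r"]]]
  have "(\<lambda>n. norm (fps_nth H n * complex_of_real r ^ n) * (inverse (fact n) * (1 / r) ^ n)) \<longlonglongrightarrow> 0" by simp
  moreover have "(\<lambda>n. norm (fps_nth H n * complex_of_real r ^ n) * (inverse (fact n) * (1 / r) ^ n))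
      = (\<lambda>n. norm (fps_nth H n) / fact n)"
    using r by (simp add: norm_mult norm_power power_divide field_simps fun_eq_iff)
  ultimately have "(\<lambda>n. norm (fps_nth H n) / fact n) \<longlonglongrightarrow> 0" by simp
  moreover have "\<forall>\<^sub>F n in sequentially. c \<le> norm (fps_nth H n) / fact n"
    using eventually_ge_at_top[of N] by eventually_elim (use growth in \<open>simp add: field_simps\<close>)
  ultimately have "c \<le> 0" by (intro tendsto_lowerbound) auto
  then show False using \<open>c > 0\<close> by simp
qed



section \<open>Divergence excludes a solution holomorphic at infinity\<close>

lemma holomorphic_at_infinity:
  assumes F: "F holomorphic_on {s. norm s > R}" and R: "R > 0"
    and bound: "\<And>s. norm s > R \<Longrightarrow> norm (F s) \<le> C / norm s ^ 3"
  shows "(\<lambda>z. if z = 0 then 0 else F (1 / z)) holomorphic_on ball 0 (1 / R)" (is "?h holomorphic_on ?B")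
proof (rule no_isolated_singularity[where K = "{0}"])
  have in_dom: "norm (1 / z) > R" if "z \<in> ?B - {0}" for z :: complex
    using that R by (simp add: norm_divide field_simps)
  have "(F \<circ> (\<lambda>z. 1 / z)) holomorphic_on ?B - {0}"
    by (rule holomorphic_on_compose_gen[OF _ F]) (use in_dom in \<open>auto intro!: holomorphic_intros\<close>)
  then show hol: "?h holomorphic_on ?B - {0}"
    by (rule holomorphic_transform) auto
  have "isCont ?h z" if z: "z \<in> ?B" for z
  proof (cases "z = 0")
    case True
    have "((\<lambda>z :: complex. norm z) \<longlongrightarrow> 0) (at 0)"
      by (rule tendsto_norm_zero[OF tendsto_ident_at])
    from tendsto_mult[OF tendsto_const[of C] tendsto_power[OF this, of 3]]
    have lim: "((\<lambda>z. C * norm (z :: complex) ^ 3) \<longlongrightarrow> 0) (at 0)" by simp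
    have "\<forall>\<^sub>F z in at 0. z \<in> ?B - {0}"
      using R by (intro eventually_at_in_open) auto
    then have "\<forall>\<^sub>F z in at 0. norm (?h z) \<le> C * norm z ^ 3"
    proof eventually_elim
      case (elim z)
      then show ?case using bound[OF in_dom[OF elim]] by (simp add: norm_divide power_divide)
    qed
    from Lim_null_comparison[OF this lim] show ?thesis by (simp add: isCont_def True)
  next
    case False
    then show ?thesis
      using hol z holomorphic_on_imp_continuous_on[OF hol] continuous_on_eq_continuous_at[of "?B - {0}" ?h]
      by (simp add: open_delete)
  qed
  then show "continuous_on ?B ?h" by (simp add: continuous_at_imp_continuous_on)
qed auto

text \<open>The equations are assumed only for Re s > 0, where they are immediate for a glued
  function; the identity theorem carries them to the whole disc in z = 1/s, including its
  centre.\<close>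

lemma inner_equation_no_decaying_solution_near_infinity:
  assumes R: "R > 0"
    and F: "F holomorphic_on {s. norm s > R}" "\<And>s. norm s > R \<Longrightarrow> norm (F s) \<le> C / norm s ^ 3"
    and G: "G holomorphic_on {s. norm s > R}" "\<And>s. norm s > R \<Longrightarrow> norm (G s) \<le> C / norm s ^ 3"
    and sol: "solves_inner {s. norm s > R \<and> Re s > 0} F G"
  shows False
proof -
  define B where "B = ball (0 :: complex) (1 / R)"
  define h where "h = (\<lambda>z. if z = 0 then 0 else F (1 / z))"
  define k where "k = (\<lambda>z. if z = 0 then 0 else G (1 / z))"
  have h: "h holomorphic_on B" and k: "k holomorphic_on B"
    using holomorphic_at_infinity[OF F(1) R F(2)] holomorphic_at_infinity[OF G(1) R G(2)]
    by (simp_all add: h_def k_def B_def)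
  have B: "open B" "connected B" "0 \<in> B" using R by (auto simp: B_def)
  define T where "T = {z \<in> B. Re z > 0}"
  have T: "open T" "T \<subseteq> B"
    using open_Int[OF B(1) open_halfspace_Re_gt[of 0]] by (auto simp: T_def Int_def)
  define c where "c = 1 / (2 * R)"
  have "0 < c" "c < 1 / R" using R by (simp_all add: c_def field_simps)
  then have "complex_of_real c \<in> T" by (simp add: T_def B_def)
  then have Tne: "T \<noteq> {}" by blast
  have chain: "deriv (\<lambda>z. if z = 0 then 0 else f (1 / z)) z = f' * (- 1 / z\<^sup>2)"
    if z: "z \<noteq> 0" and f: "(f has_field_derivative f') (at (1 / z))" for f f' and z :: complex
  proof (rule DERIV_imp_deriv)
    have "((\<lambda>z. 1 / z) has_field_derivative - 1 / z\<^sup>2) (at z)"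
      using z by (auto intro!: derivative_eq_intros simp: power2_eq_square)
    from DERIV_chain2[OF f this]
    show "((\<lambda>z. if z = 0 then 0 else f (1 / z)) has_field_derivative f' * (- 1 / z\<^sup>2)) (at z)"
      by (rule has_field_derivative_transform_within_open[where S = "- {0}"]) (use z in auto)
  qed
  \<comment> \<open>The equations are multiplied by z^2 times the denominator. In this form both
    sides are holomorphic at z = 0, as analytic continuation and comparison of power series
    demand.\<close>
  have ode_T: "(z\<^sup>2 + h z * k z) * deriv h z = (\<i> - z) * h z + z ^ 3 - \<i> / 2 * z * ((h z)\<^sup>2 - (k z)\<^sup>2)"
    "(z\<^sup>2 + h z * k z) * deriv k z = (- \<i> - z) * k z + z ^ 3 - \<i> / 2 * z * ((h z)\<^sup>2 - (k z)\<^sup>2)"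
    if z: "z \<in> T" for z
  proof -
    have z0: "z \<noteq> 0" using z by (auto simp: T_def)
    have "norm (1 / z) > R" using z z0 R by (simp add: T_def B_def norm_divide field_simps)
    moreover have "Re (1 / z) > 0"
      using z z0 by (auto simp: T_def Re_divide complex_neq_0[symmetric])
    ultimately have "1 / z \<in> {s. norm s > R \<and> Re s > 0}" by blast
    with sol have s: "1 + (1 / z)\<^sup>2 * F (1 / z) * G (1 / z) \<noteq> 0"
      "(F has_field_derivative inner_phi (1 / z) (F (1 / z)) (G (1 / z))) (at (1 / z))"
      "(G has_field_derivative inner_psi (1 / z) (F (1 / z)) (G (1 / z))) (at (1 / z))"
      unfolding solves_inner_def by blast+
    have hk: "F (1 / z) = h z" "G (1 / z) = k z" using z0 by (simp_all add: h_def k_def)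
    note s = s[unfolded hk]
    have fact: "z\<^sup>2 + h z * k z = z\<^sup>2 * (1 + (1 / z)\<^sup>2 * h z * k z)"
      using z0 by (simp add: field_simps)
    have red: "(z\<^sup>2 + h z * k z) * (N / (1 + (1 / z)\<^sup>2 * h z * k z) * (- 1 / z\<^sup>2)) = - N" for N
      unfolding fact using s(1) z0 by simp
    have dh: "deriv h z = inner_phi (1 / z) (h z) (k z) * (- 1 / z\<^sup>2)"
      unfolding h_def[abs_def] by (rule chain[OF z0]) (use s(2) in \<open>simp add: h_def\<close>)
    have dk: "deriv k z = inner_psi (1 / z) (h z) (k z) * (- 1 / z\<^sup>2)"
      unfolding k_def[abs_def] by (rule chain[OF z0]) (use s(3) in \<open>simp add: k_def\<close>)
    show "(z\<^sup>2 + h z * k z) * deriv h z = (\<i> - z) * h z + z ^ 3 - \<i> / 2 * z * ((h z)\<^sup>2 - (k z)\<^sup>2)"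
      unfolding dh inner_phi_def red using z0 by (simp add: power_divide algebra_simps)
    show "(z\<^sup>2 + h z * k z) * deriv k z = (- \<i> - z) * k z + z ^ 3 - \<i> / 2 * z * ((h z)\<^sup>2 - (k z)\<^sup>2)"
      unfolding dk inner_psi_def red using z0 by (simp add: power_divide algebra_simps)
  qed
  define H where "H = fps_expansion h 0"
  define K where "K = fps_expansion k 0"
  have H: "h has_fps_expansion H" and K: "k has_fps_expansion K"
    unfolding H_def K_def using B h k by (blast intro: has_fps_expansion_fps_expansion)+
  have identity: "(fps_X ^ 2 + H * K) * fps_deriv A
      = (fps_const c - fps_X) * A + fps_X ^ 3 - fps_const (\<i> / 2) * fps_X * (H ^ 2 - K ^ 2)"
    if a: "a holomorphic_on B" "a has_fps_expansion A"
      and T: "\<And>z. z \<in> T \<Longrightarrow> (z\<^sup>2 + h z * k z) * deriv a z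
        = (c - z) * a z + z ^ 3 - \<i> / 2 * z * ((h z)\<^sup>2 - (k z)\<^sup>2)" for a A c
  proof -
    define f where "f z = (z\<^sup>2 + h z * k z) * deriv a z" for z
    define g where "g z = (c - z) * a z + z ^ 3 - \<i> / 2 * z * ((h z)\<^sup>2 - (k z)\<^sup>2)" for z
    have "f z = g z" if "z \<in> B" for z
      by (rule analytic_continuation_open[OF \<open>open T\<close> B(1) Tne B(2) \<open>T \<subseteq> B\<close> _ _ _ that])
         (use a h k B(1) T in \<open>auto simp: f_def g_def intro!: holomorphic_intros\<close>)
    then have ev: "\<forall>\<^sub>F z in nhds 0. f z = g z"
      using eventually_nhds_in_open[OF B(1,3)] by (auto elim: eventually_mono)
    have "f has_fps_expansion (fps_X ^ 2 + H * K) * fps_deriv A"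
      unfolding f_def using H K a(2) by (intro fps_expansion_intros)
    moreover have "g has_fps_expansion
        (fps_const c - fps_X) * A + fps_X ^ 3 - fps_const (\<i> / 2) * fps_X * (H ^ 2 - K ^ 2)"
      unfolding g_def power2_eq_square using H K a(2) by (intro fps_expansion_intros)
    ultimately show ?thesis
      using has_fps_expansion_cong[OF ev refl] fps_expansion_unique_complex by metis
  qed
  have H0: "fps_nth H 0 = 0" "fps_nth K 0 = 0"
    using has_fps_expansion_imp_0_eq_fps_nth_0[OF H] has_fps_expansion_imp_0_eq_fps_nth_0[OF K]
    by (simp_all add: h_def k_def)
  \<comment> \<open>Neither \<open>H\<close> nor \<open>K\<close> has a constant term, so the shift
    by 2 divides \<open>H * K\<close> exactly by \<open>fps_X ^ 2\<close>.\<close>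
  define P where "P = fps_shift 2 (H * K)"
  have "fps_X ^ 2 * P = H * K"
  proof (rule fps_ext)
    fix n
    have "fps_nth (H * K) n = 0" if "n < 2"
    proof -
      have "n = 0 \<or> n = 1" using that by auto
      then show ?thesis using H0 by (auto simp: fps_mult_nth)
    qed
    moreover have "n - 2 + 2 = n" if "\<not> n < 2" using that by simp
    ultimately show "fps_nth (fps_X ^ 2 * P) n = fps_nth (H * K) n"
      unfolding P_def fps_X_power_mult_nth fps_shift_nth by presburger
  qed
  moreover have "(x + x * p) * d = (1 + p) * (x * d)" for x p d :: "complex fps"
    by (simp add: algebra_simps)
  ultimately have fac: "(fps_X ^ 2 + H * K) * fps_deriv A = (1 + P) * (fps_X ^ 2 * fps_deriv A)" for A
    by metis
  have "norm (fps_nth H n) \<ge> fact n / 12" if "n \<ge> 3" for n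
    by (rule inner_equation_coeff_growth[OF identity[OF h H ode_T(1), unfolded fac P_def]
        identity[OF k K ode_T(2), unfolded fac P_def] H0 that])
  then have "fps_conv_radius H = 0"
    by (intro fps_conv_radius_0_if_factorial_growth[of "1 / 12" 3]) auto
  then show False using H by (simp add: has_fps_expansion_def)
qed

section \<open>Gluing the two sectorial solutions\<close>

lemma decaying_solution_mono:
  assumes "decaying_solution C S \<phi> \<psi>" "C \<le> C'" "S' \<subseteq> S"
  shows "decaying_solution C' S' \<phi> \<psi>"
proof -
  have "C / norm s ^ 3 \<le> C' / norm s ^ 3" for s :: complex
    using assms(2) by (intro divide_right_mono) auto
  then show ?thesis
    using assms(1,3) unfolding decaying_solution_def solves_inner_def
    by (meson order_trans subset_iff)
qed

lemma distinguished_solution_imp_decaying_solution: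
  assumes "distinguished_solution D F \<phi> \<psi>"
  obtains C where "decaying_solution C D \<phi> \<psi>"
proof -
  obtain M N where M: "\<And>s. s \<in> D \<Longrightarrow> norm (s ^ 3 * \<phi> s) \<le> M" and N: "\<And>s. s \<in> D \<Longrightarrow> norm (s ^ 3 * \<psi> s) \<le> N"
    using assms unfolding distinguished_solution_def bdd_above_def by auto
  have nz: "s \<noteq> 0" if "s \<in> D" for s
    using assms that by (auto simp: distinguished_solution_def solves_inner_def)
  have "norm (f s) \<le> max M N / norm s ^ 3" if "s \<in> D" "norm (s ^ 3 * f s) \<le> max M N" for f s
    using that nz[OF that(1)] by (simp add: norm_mult norm_power field_simps)
  then have "decaying_solution (max M N) D \<phi> \<psi>"
    using assms M N unfolding decaying_solution_def distinguished_solution_def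
    by (simp add: le_max_iff_disj)
  then show ?thesis by (rule that)
qed

text \<open>In its half-plane each domain is given by |Im s| + tan \<beta> |Re s| \<ge> \<rho>, so
  it omits only a bounded triangle.\<close>

lemma sector_contains_half_exterior:
  assumes \<beta>: "0 < \<beta>" "\<beta> < pi / 2" and s: "norm s \<ge> \<rho> / min 1 (tan \<beta>)"
  shows "Re s \<ge> 0 \<Longrightarrow> s \<in> D_plus \<beta> \<rho>" "Re s \<le> 0 \<Longrightarrow> s \<in> D_minus \<beta> \<rho>"
proof -
  define \<tau> where "\<tau> = min 1 (tan \<beta>)"
  have \<tau>: "\<tau> > 0" "\<tau> \<le> 1" "\<tau> \<le> tan \<beta>" using tan_gt_zero[OF \<beta>] by (auto simp: \<tau>_def)
  have "\<rho> \<le> \<tau> * norm s" using s \<tau> by (simp add: \<tau>_def[symmetric] field_simps)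
  also have "\<dots> \<le> \<tau> * (\<bar>Re s\<bar> + \<bar>Im s\<bar>)" using \<tau> cmod_le by (intro mult_left_mono) auto
  also have "\<dots> \<le> tan \<beta> * \<bar>Re s\<bar> + \<bar>Im s\<bar>"
    using \<tau> mult_right_mono[OF \<tau>(3), of "\<bar>Re s\<bar>"] mult_right_mono[OF \<tau>(2), of "\<bar>Im s\<bar>"]
    by (simp add: distrib_left)
  finally show "Re s \<ge> 0 \<Longrightarrow> s \<in> D_plus \<beta> \<rho>" "Re s \<le> 0 \<Longrightarrow> s \<in> D_minus \<beta> \<rho>"
    by (auto simp: D_plus_def D_minus_def)
qed

text \<open>Agreement on the axis gives continuity there, and a continuous function holomorphic on
  both sides of a line is holomorphic across it.\<close>

lemma holomorphic_on_paste_across_imaginary_axis: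
  assumes "open S"
    and f: "\<And>s. s \<in> S \<Longrightarrow> Re s \<le> 0 \<Longrightarrow> f field_differentiable (at s)"
    and g: "\<And>s. s \<in> S \<Longrightarrow> Re s \<ge> 0 \<Longrightarrow> g field_differentiable (at s)"
    and eq: "\<And>s. s \<in> S \<Longrightarrow> Re s = 0 \<Longrightarrow> f s = g s"
  shows "(\<lambda>s. if Re s \<le> 0 then f s else g s) holomorphic_on S" (is "?F holomorphic_on S")
proof (rule holomorphic_on_paste_across_line[where d = 1 and k = 0])
  have "f holomorphic_on S \<inter> {z. 1 \<bullet> z < 0}"
    unfolding holomorphic_on_def using f by (auto intro: field_differentiable_at_within)
  then show "?F holomorphic_on S \<inter> {z. 1 \<bullet> z < 0}"
    by (rule holomorphic_transform) auto
  have "g holomorphic_on S \<inter> {z. 0 < 1 \<bullet> z}"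
    unfolding holomorphic_on_def using g by (auto intro: field_differentiable_at_within)
  then show "?F holomorphic_on S \<inter> {z. 0 < 1 \<bullet> z}"
    by (rule holomorphic_transform) auto
  show "continuous_on S ?F"
  proof (rule continuous_on_cases_le)
    show "continuous_on {s \<in> S. Re s \<le> 0} f" "continuous_on {s \<in> S. 0 \<le> Re s} g"
      using f g by (auto intro!: continuous_at_imp_continuous_on field_differentiable_imp_continuous_at)
  qed (use eq in \<open>auto intro: continuous_intros\<close>)
qed (use assms in auto)

theorem mainTheorem2:
  fixes \<beta> \<rho> :: real
    and \<phi>p \<psi>p \<phi>m \<psi>m :: "complex \<Rightarrow> complex"
    and \<Theta> :: complex
  assumes "0 < \<beta>" and "\<beta> < pi / 2" and "6 * (sin \<beta>)\<^sup>2 = 1"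
    and "0 < \<rho>"
    and "distinguished_solution (D_plus \<beta> \<rho>) (filtercomap Re at_top) \<phi>p \<psi>p"
    and "distinguished_solution (D_minus \<beta> \<rho>) (filtercomap Re at_bot) \<phi>m \<psi>m"
    and "((\<lambda>s. inverse s * exp (\<i> * s) * (\<phi>p s - \<phi>m s)) \<longlongrightarrow> \<Theta>)
           (inf (filtercomap Im at_bot) (principal {s. Re s = 0}))"
  shows "\<Theta> \<noteq> 0"
proof
  assume \<Theta>: "\<Theta> = 0"
  obtain Cp where Cp: "decaying_solution Cp (D_plus \<beta> \<rho>) \<phi>p \<psi>p"
    using assms(5) by (rule distinguished_solution_imp_decaying_solution)
  obtain Cm where Cm: "decaying_solution Cm (D_minus \<beta> \<rho>) \<phi>m \<psi>m"
    using assms(6) by (rule distinguished_solution_imp_decaying_solution)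
  define C where "C = max 1 (max Cp Cm)"
  have C: "C \<ge> 1" "Cp \<le> C" "Cm \<le> C" by (auto simp: C_def)
  \<comment> \<open>The first entry is the threshold for coincidence on the lower axis and also
    dominates \<open>2 * C\<close>; the second puts each half of the exterior inside its
    domain.\<close>
  define R where "R = max (132 * C\<^sup>2) (\<rho> / min 1 (tan \<beta>))"
  have "2 * C \<le> 132 * C\<^sup>2" "132 \<le> 132 * C\<^sup>2" using C(1) by (auto simp: power2_eq_square intro: order_trans[OF C(1)])
  then have R: "R \<ge> 132 * C\<^sup>2" "R \<ge> 2 * C" "R > 0" by (auto simp: R_def)
  have RD: "s \<in> D_plus \<beta> \<rho>" if "norm s \<ge> R" "Re s \<ge> 0" for s
    using sector_contains_half_exterior(1)[OF assms(1,2)] that by (simp add: R_def)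
  have LD: "s \<in> D_minus \<beta> \<rho>" if "norm s \<ge> R" "Re s \<le> 0" for s
    using sector_contains_half_exterior(2)[OF assms(1,2)] that by (simp add: R_def)
  define Sp where "Sp = {s. norm s \<ge> R \<and> Re s \<ge> 0}"
  define Sm where "Sm = {s. norm s \<ge> R \<and> Re s \<le> 0}"
  have p: "decaying_solution C Sp \<phi>p \<psi>p" and m: "decaying_solution C Sm \<phi>m \<psi>m"
    using decaying_solution_mono[OF Cp C(2)] decaying_solution_mono[OF Cm C(3)] RD LD
    by (auto simp: Sp_def Sm_def subset_iff)
  define Y where "Y = {s. norm s \<ge> R \<and> Re s = 0}"
  have pY: "decaying_solution C Y \<phi>p \<psi>p" and mY: "decaying_solution C Y \<phi>m \<psi>m"
    using decaying_solution_mono[OF p order_refl] decaying_solution_mono[OF m order_refl]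
    by (auto simp: Y_def Sp_def Sm_def subset_iff)
  have "filterlim (\<lambda>y. Complex 0 (- y)) (inf (filtercomap Im at_bot) (principal {s. Re s = 0})) at_top"
    using filterlim_uminus_at_bot_at_top
    by (simp add: filterlim_inf filterlim_filtercomap_iff filterlim_principal o_def)
  from filterlim_compose[OF assms(7) this]
  have lim: "((\<lambda>y. inverse (Complex 0 (- y)) * exp (\<i> * Complex 0 (- y)) *
      (\<phi>p (Complex 0 (- y)) - \<phi>m (Complex 0 (- y)))) \<longlongrightarrow> 0) at_top"
    unfolding \<Theta> .
  have lower: "\<phi>p (Complex 0 (- y)) = \<phi>m (Complex 0 (- y)) \<and> \<psi>p (Complex 0 (- y)) = \<psi>m (Complex 0 (- y))"
    if "y \<ge> R" for y
  proof (rule decaying_solutions_coincide_if_Stokes_zero[OF pY mY C(1) _ lim that])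
    show "Complex 0 (- r) \<in> Y" if "r \<ge> R" for r using that R by (simp add: Y_def cmod_def)
  qed (use that R in simp)
  \<comment> \<open>Conjugation preserves each half-plane, so a solution and its reflection live on
    the same set and can be compared along the horizontal ray that leaves the axis into that
    half-plane; \<epsilon> selects the side.\<close>
  have refl_sym: "\<phi> s = cnj (\<psi> (cnj s)) \<and> \<psi> s = cnj (\<phi> (cnj s))"
    if sol: "decaying_solution C S \<phi> \<psi>" and S: "S = {s. norm s \<ge> R \<and> \<epsilon> * Re s \<ge> 0}"
      and \<epsilon>: "\<epsilon> = 1 \<or> \<epsilon> = - 1" and s: "Re s = 0" "norm s \<ge> R" for \<phi> \<psi> s S and \<epsilon> :: real
  proof -
    have "decaying_solution C S (cnj \<circ> \<psi> \<circ> cnj) (cnj \<circ> \<phi> \<circ> cnj)"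
      by (rule decaying_solution_conjugate[OF sol]) (simp add: S)
    moreover have "s + complex_of_real (\<epsilon> * r) \<in> S" if "r \<ge> 0" for r
    proof -
      have "norm s \<le> norm (s + complex_of_real (\<epsilon> * r))" using s(1) by (simp add: cmod_def)
      then show ?thesis using s that \<epsilon> by (auto simp: S)
    qed
    moreover have "\<bar>Im s\<bar> \<ge> 2 * C" using s R by (simp add: cmod_def)
    ultimately show ?thesis
      using decaying_solution_unique_along_horizontal_ray[OF sol _ C(1) \<epsilon>] s(1) by simp
  qed
  have on_axis: "\<phi>p s = \<phi>m s \<and> \<psi>p s = \<psi>m s" if s: "Re s = 0" "norm s \<ge> R" for s
  proof (cases "Im s \<le> 0")
    case True
    have "s = Complex 0 (- (- Im s))" "- Im s \<ge> R" using s True by (simp_all add: complex_eq_iff cmod_def)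
    then show ?thesis using lower by metis
  next
    case False
    have "cnj s = Complex 0 (- Im s)" "Im s \<ge> R" using s False by (simp_all add: complex_eq_iff cmod_def)
    then have "\<phi>p (cnj s) = \<phi>m (cnj s) \<and> \<psi>p (cnj s) = \<psi>m (cnj s)" using lower by metis
    moreover have "\<phi>p s = cnj (\<psi>p (cnj s)) \<and> \<psi>p s = cnj (\<phi>p (cnj s))"
      by (rule refl_sym[OF p, of 1]) (use s in \<open>simp_all add: Sp_def\<close>)
    moreover have "\<phi>m s = cnj (\<psi>m (cnj s)) \<and> \<psi>m s = cnj (\<phi>m (cnj s))"
      by (rule refl_sym[OF m, of "- 1"]) (use s in \<open>simp_all add: Sm_def\<close>)
    ultimately show ?thesis by metis
  qed
  define F where "F = (\<lambda>s. if Re s \<le> 0 then \<phi>m s else \<phi>p s)"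
  define G where "G = (\<lambda>s. if Re s \<le> 0 then \<psi>m s else \<psi>p s)"
  note sol_p = p[unfolded decaying_solution_def solves_inner_def Sp_def]
  note sol_m = m[unfolded decaying_solution_def solves_inner_def Sm_def]
  have op: "open {s :: complex. norm s > R}"
    by (intro open_Collect_less continuous_intros)
  have dp: "\<phi>p field_differentiable (at s)" "\<psi>p field_differentiable (at s)" if "norm s \<ge> R" "Re s \<ge> 0" for s
    using sol_p that unfolding field_differentiable_def by blast+
  have dm: "\<phi>m field_differentiable (at s)" "\<psi>m field_differentiable (at s)" if "norm s \<ge> R" "Re s \<le> 0" for s
    using sol_m that unfolding field_differentiable_def by blast+
  have "F holomorphic_on {s. norm s > R}"
    unfolding F_def by (rule holomorphic_on_paste_across_imaginary_axis[OF op]) (use dp dm on_axis in auto)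
  moreover have "G holomorphic_on {s. norm s > R}"
    unfolding G_def by (rule holomorphic_on_paste_across_imaginary_axis[OF op]) (use dp dm on_axis in auto)
  moreover have "norm (F s) \<le> C / norm s ^ 3" "norm (G s) \<le> C / norm s ^ 3" if "norm s > R" for s
    using sol_p sol_m that by (auto simp: F_def G_def)
  \<comment> \<open>Strictly to the right of the axis the glued functions agree locally with the
    right-hand solution and inherit its derivatives.\<close>
  moreover have "solves_inner {s. norm s > R \<and> Re s > 0} F G"
    unfolding solves_inner_def
  proof
    fix s assume s: "s \<in> {s. norm s > R \<and> Re s > 0}"
    have tr: "((\<lambda>s. if Re s \<le> 0 then f s else g s) has_field_derivative D) (at s)"
      if "(g has_field_derivative D) (at s)" for f g D
      using that
      by (rule has_field_derivative_transform_within_open[where S = "{s. Re s > 0}"])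
         (use s in \<open>auto simp: open_halfspace_Re_gt\<close>)
    have "F s = \<phi>p s" "G s = \<psi>p s" using s by (simp_all add: F_def G_def)
    moreover have "s \<in> {s. norm s \<ge> R \<and> Re s \<ge> 0}" using s by simp
    ultimately show "s \<noteq> 0 \<and> 1 + s\<^sup>2 * F s * G s \<noteq> 0 \<and>
        (F has_field_derivative inner_phi s (F s) (G s)) (at s) \<and>
        (G has_field_derivative inner_psi s (F s) (G s)) (at s)"
      using sol_p tr[of \<phi>p _ \<phi>m] tr[of \<psi>p _ \<psi>m] unfolding F_def[symmetric] G_def[symmetric] by simp
  qed
  ultimately show False
    using inner_equation_no_decaying_solution_near_infinity[OF R(3)] by blast
qed

end
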